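(* Let $\mathcal H$ be a real Hilbert space and let $G(z)=C(zI-A)^{-1}b$ be a scalar transfer function with minimal real realization $(A,b,C)$, $A\in\mathbb R^{m\times m}$, $b\in\mathbb R^{m\times1}$, $C\in\mathbb R^{1\times m}$, and all poles in $|z|<1$. Suppose that for some $\delta>0$ $$\operatorname{Re}G(e^{i\theta})\le1-\delta\qquad\forall\theta\in[0,2\pi].$$ Let $\phi\colon\mathcal H\to\mathcal H$ satisfy the sector condition $$\langle\phi(\xi),\xi-\phi(\xi)\rangle\ge0\qquad\forall\xi\in\mathcal H.$$ Then every solution $(\xi_k)_{k\ge0}\subset\mathbb R^m\otimes\mathcal H$ of $$\xi_{k+1}=(A\otimes I_{\mathcal H})\xi_k+(b\otimes I_{\mathcal H})\,\phi\bigl((C\otimes I_{\mathcal H})\xi_k\bigr)$$ satisfies $$\sum_{k\ge0}\|\phi((C\otimes I_{\mathcal H})\xi_k)\|^2\le C_0\|\xi_0\|^2,$$ with $C_0=\lambda_{\max}(P)/(2\delta)$ for a symmetric matrix $P\succ0$, determined by $(A,b,C,\delta)$, whose quadratic form $V(\xi)=\langle P\xi,\xi\rangle$ satisfies $$V(A\xi+bw)-V(\xi)\le2\,w\,(w-C\xi)-2\delta w^2\qquad\forall\xi\in\mathbb R^m,\ w\in\mathbb R;$$ hence $C_0$ depends only on $(A,b,C,\delta)$.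
   Context: $I_{\mathcal H}$ is the identity of $\mathcal H$; $\mathbb R^m\otimes\mathcal H\cong\mathcal H^m$ with the product norm; $\lambda_{\max}(P)$ is the largest eigenvalue of $P$. A realization is minimal if it is controllable and observable. *)

theory Defs
  imports "HOL-Complex_Analysis.Complex_Analysis"
begin

text \<open>A scalar input or output lives in \<open>real^1\<close>, so that \<open>A\<close>, \<open>b\<close>, \<open>C\<close> are genuine
  \<open>m \<times> m\<close>, \<open>m \<times> 1\<close> and \<open>1 \<times> m\<close> matrices.\<close>

text \<open>\<open>matrix_inv\<close> is unspecified at the eigenvalues of \<open>A\<close>. This does not affect the poles of the
  transfer function, because \<open>is_pole\<close> only looks at punctured neighbourhoods.\<close>

definition transfer_function ::
    "real^'m^'m \<Rightarrow> real^1^'m \<Rightarrow> real^'m^1 \<Rightarrow> complex \<Rightarrow> complex" where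
  "transfer_function A b C z =
     (map_matrix complex_of_real C
        ** matrix_inv (mat z - map_matrix complex_of_real A)
        ** map_matrix complex_of_real b) $ 1 $ 1"

text \<open>Kalman rank conditions: \<open>[B, AB, \<dots>, A\<^sup>m\<^sup>-\<^sup>1B]\<close> and \<open>[C; CA; \<dots>; CA\<^sup>m\<^sup>-\<^sup>1]\<close> have rank \<open>m\<close>.
  The iterates are \<open>A\<^sup>k B\<close> and \<open>C A\<^sup>k\<close> respectively (the power operation on type \<open>vec\<close> would be
  componentwise, not the matrix power).\<close>

definition controllable :: "real^'m^'m \<Rightarrow> real^'p^'m \<Rightarrow> bool" where
  "controllable A B \<longleftrightarrow>
     dim (\<Union>k<CARD('m). columns (((\<lambda>M. A ** M) ^^ k) B)) = CARD('m)"

definition observable :: "real^'m^'m \<Rightarrow> real^'m^'q \<Rightarrow> bool" where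
  "observable A C \<longleftrightarrow>
     dim (\<Union>k<CARD('m). rows (((\<lambda>M. M ** A) ^^ k) C)) = CARD('m)"

definition minimal_realization :: "real^'m^'m \<Rightarrow> real^'p^'m \<Rightarrow> real^'m^'q \<Rightarrow> bool" where
  "minimal_realization A B C \<longleftrightarrow> controllable A B \<and> observable A C"

text \<open>The operator \<open>M \<otimes> I\<^sub>H\<close>, where \<open>\<real>\<^sup>n \<otimes> H\<close> is identified with \<open>H\<^sup>n\<close>, i.e. the type \<open>'h^'n\<close> with
  its library (product) norm.\<close>

definition tensor_id :: "real^'n^'k \<Rightarrow> 'h::real_vector^'n \<Rightarrow> 'h^'k" where
  "tensor_id M x = (\<chi> i. \<Sum>j\<in>UNIV. (M $ i $ j) *\<^sub>R (x $ j))"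

definition sector_condition :: "('h::real_inner \<Rightarrow> 'h) \<Rightarrow> bool" where
  "sector_condition \<phi> \<longleftrightarrow> (\<forall>x. inner (\<phi> x) (x - \<phi> x) \<ge> 0)"

definition lambda_max :: "real^'m^'m \<Rightarrow> real" where
  "lambda_max P = Max {l. \<exists>v. v \<noteq> 0 \<and> P *v v = l *\<^sub>R v}"

definition quad_form :: "real^'m^'m \<Rightarrow> real^'m \<Rightarrow> real" where
  "quad_form P x = inner (P *v x) x"

definition sym_pos_def :: "real^'m^'m \<Rightarrow> bool" where
  "sym_pos_def P \<longleftrightarrow> transpose P = P \<and> (\<forall>x. x \<noteq> 0 \<longrightarrow> quad_form P x > 0)"

definition dissipative ::
    "real^'m^'m \<Rightarrow> real^1^'m \<Rightarrow> real^'m^1 \<Rightarrow> real \<Rightarrow> real^'m^'m \<Rightarrow> bool" where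
  "dissipative A b C \<delta> P \<longleftrightarrow>
     (\<forall>x w. quad_form P (A *v x + b *v vec w) - quad_form P x
              \<le> 2 * w * (w - (C *v x) $ 1) - 2 * \<delta> * w\<^sup>2)"

text \<open>The matrix \<open>P\<close> determined by \<open>(A, b, C, \<delta>)\<close>. Choosing it by a constant whose type does not
  mention the Hilbert space expresses that \<open>P\<close>, and hence the bound, is independent of the Hilbert
  space, the nonlinearity and the trajectory; an existential quantifier in a theorem with a free
  type variable for the Hilbert space would not. That a matrix with these properties exists
  is not assumed here.\<close>

definition storage_matrix ::
    "real^'m^'m \<Rightarrow> real^1^'m \<Rightarrow> real^'m^1 \<Rightarrow> real \<Rightarrow> real^'m^'m" where
  "storage_matrix A b C \<delta> = (SOME P. sym_pos_def P \<and> dissipative A b C \<delta> P)"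

end

theory Submission
  imports Defs
begin

text \<open>The matrix \<open>P\<close> is the available storage: \<open>V x\<close> is the supremum, over finite input sequences, of
  the energy that can be extracted from the state \<open>x\<close>. It is finite because every state is reachable
  from \<open>0\<close> and, by the frequency inequality, nothing can be extracted from \<open>0\<close>. A supremum of jointly
  quadratic costs over a linear space of inputs satisfies the parallelogram law, hence it is a
  quadratic form; observability makes it definite, and dynamic programming gives the dissipation
  inequality.

  Stability enters only through summability of the impulse response \<open>C A\<^sup>n b\<close>. In the variable
  \<open>u = 1/z\<close> the transfer function is \<open>u\<close> times a quotient of polynomials whose singularities in the closed
  unit disc are removable, and the \<open>C A\<^sup>n b\<close> are the Taylor coefficients of that quotient at \<open>0\<close>.

  A finite family of vectors in a Hilbert space expands in a finite orthogonal family, which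
  transfers the scalar dissipation inequality to \<open>\<real>\<^sup>m \<otimes> H\<close>; with the sector condition it telescopes
  along trajectories.\<close>

no_notation fps_nth (infixl \<open>$\<close> 75)

subsection \<open>Quadratic forms on Hilbert space tuples\<close>

lemma quad_form_alt: "quad_form P x = (\<Sum>i\<in>UNIV. \<Sum>j\<in>UNIV. P $ i $ j * (x $ i * x $ j))"
proof -
  have "(P *v x) $ i * x $ i = (\<Sum>j\<in>UNIV. P $ i $ j * (x $ i * x $ j))" for i
    by (simp add: matrix_vector_mult_def sum_distrib_right sum_distrib_left algebra_simps)
  then show ?thesis by (simp add: quad_form_def inner_vec_def)
qed

lemma quad_form_scaleR: "quad_form P (t *\<^sub>R x) = t\<^sup>2 * quad_form P x"
  by (simp add: quad_form_def matrix_vector_mult_scaleR power2_eq_square)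

lemma inner_symmetric_matrix:
  fixes P :: "real^'m^'m"
  assumes "transpose P = P"
  shows "inner (P *v x) y = inner x (P *v y)"
proof -
  have "P *v x = x v* P"
    using transpose_matrix_vector[of P x] unfolding assms .
  then show ?thesis
    using dot_lmul_matrix[of x P y] by (simp only:)
qed

lemma quad_form_add:
  assumes "transpose P = P"
  shows "quad_form P (x + y) = quad_form P x + 2 * inner (P *v x) y + quad_form P y"
proof -
  have "inner (P *v y) x = inner (P *v x) y"
    unfolding inner_symmetric_matrix[OF assms, of y x] by (rule inner_commute)
  then show ?thesis
    by (simp add: quad_form_def matrix_vector_right_distrib inner_add_left inner_add_right)
qed

text \<open>\<open>lambda_max\<close> is a \<open>Max\<close>, which is informative only on a finite
  set. Eigenvectors of distinct eigenvalues are orthogonal, hence independent, so there are finitely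
  many eigenvalues.\<close>

lemma finite_eigenvalues_symmetric:
  fixes P :: "real^'m^'m"
  assumes "transpose P = P"
  shows "finite {l. \<exists>v. v \<noteq> 0 \<and> P *v v = l *\<^sub>R v}" (is "finite ?S")
proof -
  define f where "f l = (SOME v. v \<noteq> 0 \<and> P *v v = l *\<^sub>R v)" for l
  have f: "f l \<noteq> 0 \<and> P *v f l = l *\<^sub>R f l" if "l \<in> ?S" for l
    unfolding f_def by (rule someI_ex) (use that in simp)
  have orth: "inner (f k) (f l) = 0" if "k \<in> ?S" "l \<in> ?S" "k \<noteq> l" for k l
  proof -
    have "k * inner (f k) (f l) = inner (P *v f k) (f l)"
      using f[OF that(1)] by simp
    also have "\<dots> = inner (f k) (P *v f l)"
      by (rule inner_symmetric_matrix[OF assms])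
    also have "\<dots> = l * inner (f k) (f l)"
      using f[OF that(2)] by simp
    finally show ?thesis using that(3) by simp
  qed
  have inj: "inj_on f ?S"
  proof (rule inj_onI, rule ccontr)
    fix k l assume kl: "k \<in> ?S" "l \<in> ?S" "f k = f l" "k \<noteq> l"
    then have "inner (f k) (f k) = 0" using orth[of k l] by simp
    then show False using f[OF kl(1)] by simp
  qed
  have "pairwise orthogonal (f ` ?S)"
    using orth by (auto simp: pairwise_def orthogonal_def)
  moreover have "0 \<notin> f ` ?S"
  proof
    assume "0 \<in> f ` ?S"
    then obtain k where k: "0 = f k" "k \<in> ?S" by (rule imageE)
    then show False using f[OF k(2)] by simp
  qed
  ultimately have "finite (f ` ?S)"
    using pairwise_orthogonal_independent independent_bound by blast
  then show ?thesis using inj finite_imageD by blast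
qed

text \<open>Rayleigh's principle: the form attains its maximum \<open>M\<close> over the unit sphere
  at some \<open>v\<close>, and first-order optimality makes \<open>v\<close> an eigenvector for
  \<open>M\<close>, so \<open>lambda_max\<close> is at least \<open>M\<close>.\<close>

lemma quad_form_le_lambda_max:
  fixes P :: "real^'m^'m"
  assumes sym: "transpose P = P"
  shows "quad_form P x \<le> lambda_max P * (norm x)\<^sup>2"
proof -
  have "continuous_on (sphere 0 1) (quad_form P)"
    unfolding quad_form_def
    by (intro continuous_intros linear_continuous_on) auto
  moreover have "sphere (0 :: real^'m) 1 \<noteq> {}" by simp
  ultimately obtain v where v: "v \<in> sphere 0 1" and max: "\<And>y. y \<in> sphere 0 1 \<Longrightarrow> quad_form P y \<le> quad_form P v"
    by (metis continuous_attains_sup compact_sphere)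
  define M where "M = quad_form P v"
  have le: "quad_form P y \<le> M * (norm y)\<^sup>2" for y
  proof (cases "y = 0")
    case True
    then show ?thesis by (simp add: quad_form_def)
  next
    case False
    have "quad_form P ((1 / norm y) *\<^sub>R y) \<le> M"
      unfolding M_def using False by (intro max) simp
    then show ?thesis
      using False by (simp add: quad_form_scaleR power_divide divide_simps)
  qed
  define y where "y = P *v v - M *\<^sub>R v"
  have vv: "(norm v)\<^sup>2 = 1" using v by simp
  define K where "K = M * (norm y)\<^sup>2 - quad_form P y"
  have "0 \<le> K" using le[of y] by (simp add: K_def)
  \<comment> \<open>Maximality of \<open>M\<close> tested on \<open>v + t y\<close>, with
    \<open>y\<close> the eigenvector residual. For small positive \<open>t\<close> the linear term
    dominates, which forces \<open>y = 0\<close>.\<close>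
  have ineq: "0 \<le> t\<^sup>2 * K - 2 * t * (norm y)\<^sup>2" for t
  proof -
    have "inner y y = inner (P *v v) y - M * inner v y"
      by (simp add: y_def inner_diff_left)
    then have Py: "inner (P *v v) y = (norm y)\<^sup>2 + M * inner v y"
      by (simp add: power2_norm_eq_inner)
    have "quad_form P (v + t *\<^sub>R y) = M + 2 * t * inner (P *v v) y + t\<^sup>2 * quad_form P y"
      by (simp add: quad_form_add[OF sym] quad_form_scaleR M_def)
    moreover have "(norm (v + t *\<^sub>R y))\<^sup>2 = 1 + 2 * t * inner v y + t\<^sup>2 * (norm y)\<^sup>2"
      using vv unfolding power2_norm_eq_inner
      by (simp add: inner_add_left inner_add_right inner_commute power2_eq_square)
    ultimately show ?thesis
      using le[of "v + t *\<^sub>R y"] by (simp add: K_def Py algebra_simps)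
  qed
  have "y = 0"
  proof (rule ccontr)
    assume "y \<noteq> 0"
    then have n: "0 < (norm y)\<^sup>2" by simp
    show False
    proof (cases "K = 0")
      case True
      then show False using ineq[of 1] n by simp
    next
      case False
      with \<open>0 \<le> K\<close> have "0 < K" by simp
      \<comment> \<open>\<open>(norm y)^2 / K\<close> minimizes the polynomial in \<open>t\<close>;
        the minimum is negative.\<close>
      then have "((norm y)\<^sup>2 / K)\<^sup>2 * K - 2 * ((norm y)\<^sup>2 / K) * (norm y)\<^sup>2 = - ((norm y)\<^sup>2)\<^sup>2 / K"
        by (simp add: field_simps power2_eq_square)
      also have "\<dots> < 0" using n \<open>0 < K\<close> by simp
      finally show False using ineq[of "(norm y)\<^sup>2 / K"] by linarith
    qed
  qed
  then have "M \<in> {l. \<exists>v. v \<noteq> 0 \<and> P *v v = l *\<^sub>R v}"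
    using v by (intro CollectI exI[of _ v]) (auto simp: y_def)
  then have "M \<le> lambda_max P"
    unfolding lambda_max_def by (intro Max_ge finite_eigenvalues_symmetric sym)
  then show ?thesis
    by (intro order_trans[OF le[of x]] mult_right_mono) simp_all
qed

section \<open>Lifting scalar quadratic inequalities to Hilbert space\<close>

text \<open>Each inequality involves only finitely many vectors, so Gram-Schmidt on their span
  replaces a basis of the whole space. \<open>E\<close> is not normalized, which is why the weights
  \<open>(norm e)^2\<close> appear below.\<close>

lemma finite_orthogonal_expansion:
  fixes S :: "'h::real_inner set"
  assumes "finite S"
  obtains E a where "finite E" "pairwise orthogonal E" "\<And>x. x \<in> S \<Longrightarrow> (\<Sum>e\<in>E. a x e *\<^sub>R e) = x"
proof -
  obtain E where E: "finite E" "span E = span S" "pairwise orthogonal E"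
    using basis_orthogonal[OF assms] by blast
  define a where "a x = (SOME a. (\<Sum>e\<in>E. a e *\<^sub>R e) = x)" for x
  have "(\<Sum>e\<in>E. a x e *\<^sub>R e) = x" if "x \<in> S" for x
  proof -
    have "x \<in> span E" using that E(2) span_superset by blast
    then obtain c where "(\<Sum>e\<in>E. c e *\<^sub>R e) = x"
      unfolding span_finite[OF E(1)] by auto
    then show ?thesis 
      unfolding a_def by (rule someI[of "\<lambda>a. (\<Sum>e\<in>E. a e *\<^sub>R e) = x"])
  qed
  with E(1,3) that show ?thesis by blast
qed

lemma inner_orthogonal_expansion:
  fixes E :: "'h::real_inner set"
  assumes "finite E" "pairwise orthogonal E"
  shows "inner (\<Sum>e\<in>E. a e *\<^sub>R e) (\<Sum>e\<in>E. d e *\<^sub>R e) = (\<Sum>e\<in>E. (norm e)\<^sup>2 * (a e * d e))"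
proof -
  have "inner (\<Sum>e\<in>E. a e *\<^sub>R e) (\<Sum>e\<in>E. d e *\<^sub>R e)
      = (\<Sum>f\<in>E. \<Sum>e\<in>E. d f * (a e * inner e f))"
    by (simp add: inner_sum_left inner_sum_right sum_distrib_left)
  also have "\<dots> = (\<Sum>f\<in>E. \<Sum>e\<in>E. if f = e then (norm e)\<^sup>2 * (a e * d e) else 0)"
    using assms(2)
    by (intro sum.cong refl) (auto simp: pairwise_def orthogonal_def power2_norm_eq_inner)
  finally show ?thesis using assms(1) by simp
qed

text \<open>This is the quadratic form of \<open>P \<otimes> I\<close>, written in the Gram matrix
  of the components.\<close>

definition tensor_quad_form :: "real^'m^'m \<Rightarrow> 'h::real_inner^'m \<Rightarrow> real" where
  "tensor_quad_form P x = (\<Sum>i\<in>UNIV. \<Sum>j\<in>UNIV. P $ i $ j * inner (x $ i) (x $ j))"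

text \<open>Along an orthogonal family the tensor form splits into copies of the scalar one, so that
  every scalar quadratic inequality carries over to the Hilbert space.\<close>

lemma tensor_quad_form_orthogonal:
  fixes E :: "'h::real_inner set"
  assumes "finite E" "pairwise orthogonal E"
  shows "tensor_quad_form P (\<chi> i. \<Sum>e\<in>E. a e $ i *\<^sub>R e) = (\<Sum>e\<in>E. (norm e)\<^sup>2 * quad_form P (a e))"
proof -
  have "tensor_quad_form P (\<chi> i. \<Sum>e\<in>E. a e $ i *\<^sub>R e)
     = (\<Sum>i\<in>UNIV. \<Sum>j\<in>UNIV. \<Sum>e\<in>E. (norm e)\<^sup>2 * (P $ i $ j * (a e $ i * a e $ j)))"
    by (simp add: tensor_quad_form_def inner_orthogonal_expansion[OF assms] sum_distrib_left mult_ac)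
  also have "\<dots> = (\<Sum>i\<in>UNIV. \<Sum>e\<in>E. \<Sum>j\<in>UNIV. (norm e)\<^sup>2 * (P $ i $ j * (a e $ i * a e $ j)))"
    by (intro sum.cong refl sum.swap)
  also have "\<dots> = (\<Sum>e\<in>E. \<Sum>i\<in>UNIV. \<Sum>j\<in>UNIV. (norm e)\<^sup>2 * (P $ i $ j * (a e $ i * a e $ j)))"
    by (rule sum.swap)
  finally show ?thesis
    by (simp add: quad_form_alt sum_distrib_left)
qed

lemma tensor_id_expansion:
  "tensor_id M (\<chi> i. \<Sum>e\<in>E. a e $ i *\<^sub>R e) = (\<chi> i. \<Sum>e\<in>E. (M *v a e) $ i *\<^sub>R e)"
proof -
  have "(\<Sum>j\<in>UNIV. M $ i $ j *\<^sub>R (\<Sum>e\<in>E. a e $ j *\<^sub>R e)) = (\<Sum>e\<in>E. (\<Sum>j\<in>UNIV. M $ i $ j * a e $ j) *\<^sub>R e)" for i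
    by (simp add: scaleR_sum_left scaleR_sum_right) (rule sum.swap)
  then show ?thesis
    by (simp add: tensor_id_def vec_eq_iff matrix_vector_mult_def)
qed

text \<open>Both bounds are the scalar ones, summed with the nonnegative weights
  \<open>(norm e)^2\<close>; the product norm splits with the same weights.\<close>

lemma tensor_quad_form_bounds:
  fixes x :: "'h::real_inner^'m"
  assumes "sym_pos_def P"
  shows "0 \<le> tensor_quad_form P x" "tensor_quad_form P x \<le> lambda_max P * (norm x)\<^sup>2"
proof -
  have sym: "transpose P = P" and pos: "0 \<le> quad_form P y" for y
    using assms by (auto simp: sym_pos_def_def quad_form_def) (metis inner_zero_right order.strict_iff_order order_refl)
  obtain E a where E: "finite E" "pairwise orthogonal E"
    and a: "\<And>y. y \<in> range (($) x) \<Longrightarrow> (\<Sum>e\<in>E. a y e *\<^sub>R e) = y"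
    using finite_orthogonal_expansion[of "range (($) x)"] by auto
  define d where "d e = (\<chi> i. a (x $ i) e)" for e
  have x: "x = (\<chi> i. \<Sum>e\<in>E. d e $ i *\<^sub>R e)"
    using a by (auto simp: d_def vec_eq_iff)
  have xi: "x $ i = (\<Sum>e\<in>E. d e $ i *\<^sub>R e)" for i
    using a by (auto simp: d_def)
  have q: "tensor_quad_form P x = (\<Sum>e\<in>E. (norm e)\<^sup>2 * quad_form P (d e))"
    by (rule tensor_quad_form_orthogonal[OF E, of P d, folded x])
  then show "0 \<le> tensor_quad_form P x"
    using pos by (simp add: sum_nonneg)
  have "(norm x)\<^sup>2 = (\<Sum>i\<in>UNIV. inner (x $ i) (x $ i))"
    by (simp add: norm_vec_def L2_set_def sum_nonneg power2_norm_eq_inner)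
  also have "\<dots> = (\<Sum>i\<in>UNIV. \<Sum>e\<in>E. (norm e)\<^sup>2 * (d e $ i * d e $ i))"
    by (simp add: xi inner_orthogonal_expansion[OF E])
  also have "\<dots> = (\<Sum>e\<in>E. (norm e)\<^sup>2 * (norm (d e))\<^sup>2)"
    by (subst sum.swap) (simp add: power2_norm_eq_inner inner_vec_def sum_distrib_left)
  finally have n: "(norm x)\<^sup>2 = (\<Sum>e\<in>E. (norm e)\<^sup>2 * (norm (d e))\<^sup>2)" .
  have "tensor_quad_form P x \<le> (\<Sum>e\<in>E. (norm e)\<^sup>2 * (lambda_max P * (norm (d e))\<^sup>2))"
    unfolding q by (intro sum_mono mult_left_mono quad_form_le_lambda_max sym) simp
  also have "\<dots> = lambda_max P * (norm x)\<^sup>2"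
    unfolding n by (simp add: sum_distrib_left mult_ac)
  finally show "tensor_quad_form P x \<le> lambda_max P * (norm x)\<^sup>2" .
qed

text \<open>The input \<open>w\<close> is expanded together with the components of \<open>x\<close>,
  so that state, input and output share one orthogonal family; the scalar inequality is then applied
  in each direction \<open>e\<close>.\<close>

lemma tensor_dissipation:
  fixes x :: "'h::real_inner^'m" and w :: 'h
  assumes "dissipative A b C \<delta> P"
  shows "tensor_quad_form P (tensor_id A x + tensor_id b (vec w)) - tensor_quad_form P x
           \<le> 2 * inner w (w - tensor_id C x $ 1) - 2 * \<delta> * (norm w)\<^sup>2"
proof -
  obtain E a where E: "finite E" "pairwise orthogonal E"
    and a: "\<And>y. y \<in> insert w (range (($) x)) \<Longrightarrow> (\<Sum>e\<in>E. a y e *\<^sub>R e) = y"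
    using finite_orthogonal_expansion[of "insert w (range (($) x))"] by auto
  define d where "d e = (\<chi> i. a (x $ i) e)" for e
  have x: "x = (\<chi> i. \<Sum>e\<in>E. d e $ i *\<^sub>R e)"
    using a by (auto simp: d_def vec_eq_iff)
  have w: "w = (\<Sum>e\<in>E. a w e *\<^sub>R e)" using a by auto
  have vw: "(vec w :: 'h^1) = (\<chi> i. \<Sum>e\<in>E. vec (a w e) $ i *\<^sub>R e)"
    by (simp add: vec_eq_iff w[symmetric])
  have "tensor_id A x = (\<chi> i. \<Sum>e\<in>E. (A *v d e) $ i *\<^sub>R e)"
    by (rule tensor_id_expansion[of A d E, folded x])
  moreover have "tensor_id b (vec w) = (\<chi> i. \<Sum>e\<in>E. (b *v vec (a w e)) $ i *\<^sub>R e)"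
    by (rule tensor_id_expansion[of b "\<lambda>e. vec (a w e)" E, folded vw])
  ultimately have "tensor_id A x + tensor_id b (vec w) = (\<chi> i. \<Sum>e\<in>E. (A *v d e + b *v vec (a w e)) $ i *\<^sub>R e)"
    by (simp add: vec_eq_iff scaleR_add_left sum.distrib)
  then have q1: "tensor_quad_form P (tensor_id A x + tensor_id b (vec w))
      = (\<Sum>e\<in>E. (norm e)\<^sup>2 * quad_form P (A *v d e + b *v vec (a w e)))"
    by (simp only: tensor_quad_form_orthogonal[OF E])
  have q0: "tensor_quad_form P x = (\<Sum>e\<in>E. (norm e)\<^sup>2 * quad_form P (d e))"
    by (rule tensor_quad_form_orthogonal[OF E, of P d, folded x])
  have "tensor_id C x $ 1 = (\<Sum>e\<in>E. (C *v d e) $ 1 *\<^sub>R e)"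
    by (subst x) (simp add: tensor_id_expansion)
  then have diff: "w - tensor_id C x $ 1 = (\<Sum>e\<in>E. (a w e - (C *v d e) $ 1) *\<^sub>R e)"
    by (simp add: scaleR_diff_left sum_subtractf w[symmetric])
  have s1: "inner w (w - tensor_id C x $ 1)
      = (\<Sum>e\<in>E. (norm e)\<^sup>2 * (a w e * (a w e - (C *v d e) $ 1)))"
    by (rule inner_orthogonal_expansion[OF E, of "a w" "\<lambda>e. a w e - (C *v d e) $ 1", folded w diff])
  have s2: "(norm w)\<^sup>2 = (\<Sum>e\<in>E. (norm e)\<^sup>2 * (a w e * a w e))"
    unfolding power2_norm_eq_inner[of w]
    by (rule inner_orthogonal_expansion[OF E, of "a w" "a w", folded w])
  have "tensor_quad_form P (tensor_id A x + tensor_id b (vec w)) - tensor_quad_form P x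
      = (\<Sum>e\<in>E. (norm e)\<^sup>2 * (quad_form P (A *v d e + b *v vec (a w e)) - quad_form P (d e)))"
    unfolding q0 q1 by (simp add: sum_subtractf right_diff_distrib)
  also have "\<dots> \<le> (\<Sum>e\<in>E. (norm e)\<^sup>2 *
      (2 * a w e * (a w e - (C *v d e) $ 1) - 2 * \<delta> * (a w e)\<^sup>2))"
    using assms unfolding dissipative_def by (intro sum_mono mult_left_mono) auto
  also have "\<dots> = 2 * inner w (w - tensor_id C x $ 1) - 2 * \<delta> * (norm w)\<^sup>2"
    unfolding s1 s2 by (simp add: sum_distrib_left sum_subtractf[symmetric] algebra_simps power2_eq_square)
  finally show ?thesis .
qed

text \<open>The sector condition makes the first term of the supply nonpositive, so the storage
  drops by at least \<open>2 * \<delta> * (norm (u k))^2\<close> per step. Telescoping uses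
  nonnegativity at the end and the \<open>lambda_max\<close> bound at the start.\<close>

lemma trajectory_input_energy:
  fixes \<phi> :: "'h::real_inner \<Rightarrow> 'h" and \<xi> :: "nat \<Rightarrow> 'h^'m"
  assumes P: "sym_pos_def P" "dissipative A b C \<delta> P" and "\<delta> > 0" and sec: "sector_condition \<phi>"
    and step: "\<And>k. \<xi> (Suc k) = tensor_id A (\<xi> k) + tensor_id b (vec (\<phi> (tensor_id C (\<xi> k) $ 1)))"
  defines "u \<equiv> \<lambda>k. \<phi> (tensor_id C (\<xi> k) $ 1)"
  shows "summable (\<lambda>k. (norm (u k))\<^sup>2)"
    and "(\<Sum>k. (norm (u k))\<^sup>2) \<le> lambda_max P / (2 * \<delta>) * (norm (\<xi> 0))\<^sup>2"
proof -
  have dec: "2 * \<delta> * (norm (u k))\<^sup>2 \<le> tensor_quad_form P (\<xi> k) - tensor_quad_form P (\<xi> (Suc k))" for k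
  proof -
    have "0 \<le> inner (u k) (tensor_id C (\<xi> k) $ 1 - u k)"
      using sec by (simp add: sector_condition_def u_def)
    then have "inner (u k) (u k - tensor_id C (\<xi> k) $ 1) \<le> 0"
      by (simp add: inner_diff_right)
    then show ?thesis
      using tensor_dissipation[OF P(2), of "\<xi> k" "u k"] step[of k] by (simp add: u_def)
  qed
  have le: "(\<Sum>k<n. (norm (u k))\<^sup>2) \<le> lambda_max P / (2 * \<delta>) * (norm (\<xi> 0))\<^sup>2" for n
  proof -
    have "2 * \<delta> * (\<Sum>k<n. (norm (u k))\<^sup>2) \<le> tensor_quad_form P (\<xi> 0) - tensor_quad_form P (\<xi> n)"
    proof (induction n)
      case (Suc n)
      then show ?case using dec[of n] by (simp add: distrib_left)
    qed simp
    also have "\<dots> \<le> lambda_max P * (norm (\<xi> 0))\<^sup>2"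
      using tensor_quad_form_bounds[OF P(1)] by (smt (verit))
    finally show ?thesis using \<open>\<delta> > 0\<close> by (simp add: field_simps)
  qed
  show s: "summable (\<lambda>k. (norm (u k))\<^sup>2)"
    using le by (intro summableI_nonneg_bounded) auto
  show "(\<Sum>k. (norm (u k))\<^sup>2) \<le> lambda_max P / (2 * \<delta>) * (norm (\<xi> 0))\<^sup>2"
    using le by (intro suminf_le_const s) auto
qed

subsection \<open>Quadratic forms from the parallelogram law\<close>

text \<open>Subtracting \<open>t * f 1\<close> leaves an additive function \<open>g\<close> that
  vanishes on the integers, hence is periodic and bounded everywhere; since
  \<open>g (n t) = n g t\<close>, it must be zero.\<close>

lemma additive_bounded_imp_linear:
  fixes f :: "real \<Rightarrow> real"
  assumes add: "\<And>s t. f (s + t) = f s + f t"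
    and bd: "\<And>t. 0 \<le> t \<Longrightarrow> t \<le> 1 \<Longrightarrow> \<bar>f t\<bar> \<le> M"
  shows "f t = t * f 1"
proof -
  define g where "g t = f t - t * f 1" for t
  have gadd: "g (s + t) = g s + g t" for s t
    by (simp add: g_def add algebra_simps)
  have g0: "g 0 = 0" using gadd[of 0 0] by simp
  have gneg: "g (- t) = - g t" for t using gadd[of t "- t"] g0 by simp
  have gn: "g (real n * t) = real n * g t" for n t
    by (induction n) (simp_all add: g0 gadd algebra_simps)
  have gi: "g (of_int k) = 0" for k
  proof -
    have n: "g (real n) = 0" for n using gn[of n 1] by (simp add: g_def)
    show ?thesis using n[of "nat k"] n[of "nat (- k)"] gneg[of "of_int (- k)"] by (cases "0 \<le> k") auto
  qed
  have gb: "\<bar>g t\<bar> \<le> 2 * M" for t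
  proof -
    have "g t = g (of_int \<lfloor>t\<rfloor> + frac t)" by (simp add: frac_def)
    also have "\<dots> = g (frac t)" by (simp add: gadd gi)
    finally have e: "g t = f (frac t) - frac t * f 1" by (simp add: g_def)
    have "\<bar>f (frac t)\<bar> \<le> M" using bd[of "frac t"] frac_lt_1[of t] by simp
    moreover have "\<bar>frac t * f 1\<bar> \<le> 1 * M"
      unfolding abs_mult using bd[of 1] frac_lt_1[of t] by (intro mult_mono) auto
    ultimately show ?thesis unfolding e by linarith
  qed
  have "g t = 0"
  proof (rule ccontr)
    assume "g t \<noteq> 0"
    then obtain n where "2 * M < real n * \<bar>g t\<bar>"
      using reals_Archimedean3[of "\<bar>g t\<bar>"] by auto
    then show False using gb[of "real n * t"] by (simp add: gn abs_mult)
  qed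
  then show ?thesis by (simp add: g_def)
qed

text \<open>The Jordan-von Neumann argument: the polarization of \<open>V\<close> is biadditive by
  the parallelogram law, and nonnegativity of \<open>V\<close> supplies the local bound that takes
  the place of continuity in passing from additive to homogeneous.\<close>

lemma parallelogram_imp_quad_form:
  fixes V :: "real^'m \<Rightarrow> real"
  assumes par: "\<And>x y. V (x + y) + V (x - y) = 2 * V x + 2 * V y"
    and nonneg: "\<And>x. 0 \<le> V x"
    and scale: "\<And>t x. V (t *\<^sub>R x) = t\<^sup>2 * V x"
  obtains P where "transpose P = P" "\<And>x. V x = quad_form P x"
proof -
  define B where "B x y = (V (x + y) - V (x - y)) / 4" for x y
  have even: "V (- x) = V x" for x using scale[of "-1" x] by simp
  have "V 0 = 0" using scale[of 0 0] by simp
  have B0: "B 0 y = 0" for y by (simp add: B_def even)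
  have comm: "B x y = B y x" for x y
    using even[of "x - y"] by (simp add: B_def add.commute)
  have diag: "B x x = V x" for x
    using scale[of 2 x] \<open>V 0 = 0\<close> by (simp add: B_def scaleR_2)
  \<comment> \<open>The parallelogram law at \<open>x + z\<close>, \<open>y + z\<close> and at
    \<open>x - z\<close>, \<open>y - z\<close>; the common term \<open>V (x - y)\<close> cancels on
    subtraction.\<close>
  have dbl: "B x z + B y z = B (x + y) (z + z) / 2" for x y z
  proof -
    have "V (x + y + (z + z)) + V (x - y) = 2 * V (x + z) + 2 * V (y + z)"
      using par[of "x + z" "y + z"] by (simp add: algebra_simps)
    moreover have "V (x + y - (z + z)) + V (x - y) = 2 * V (x - z) + 2 * V (y - z)"
      using par[of "x - z" "y - z"] by (simp add: algebra_simps)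
    ultimately show ?thesis unfolding B_def by argo
  qed
  \<comment> \<open>The doubling identity for the pair \<open>x + y\<close>, \<open>0\<close> turns
    the right-hand side back into \<open>B (x + y) z\<close>.\<close>
  have add: "B (x + y) z = B x z + B y z" for x y z
    using dbl[of x z y] dbl[of "x + y" z 0] B0 by simp
  have hom: "B (t *\<^sub>R x) y = t * B x y" for t x y
  proof -
    \<comment> \<open>For \<open>t\<close> in \<open>[0, 1]\<close> the nonnegative numbers
      \<open>V (t x + y)\<close> and \<open>V (t x - y)\<close> sum to at most
      \<open>2 V x + 2 V y\<close>, which bounds their difference.\<close>
    have "B (t *\<^sub>R x) y = t * B (1 *\<^sub>R x) y"
    proof (rule additive_bounded_imp_linear[where M = "V x + V y"])
      show "B ((s + t) *\<^sub>R x) y = B (s *\<^sub>R x) y + B (t *\<^sub>R x) y" for s t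
        by (simp add: add scaleR_add_left)
      fix t :: real assume t: "0 \<le> t" "t \<le> 1"
      have "t\<^sup>2 * V x \<le> 1 * V x"
        using t nonneg by (intro mult_right_mono) (simp_all add: power_le_one)
      then have "V (t *\<^sub>R x + y) + V (t *\<^sub>R x - y) \<le> 2 * V x + 2 * V y"
        by (simp add: par scale)
      moreover have "0 \<le> V x" "0 \<le> V y" "0 \<le> V (t *\<^sub>R x + y)" "0 \<le> V (t *\<^sub>R x - y)"
        using nonneg by auto
      ultimately show "\<bar>B (t *\<^sub>R x) y\<bar> \<le> V x + V y"
        by (simp add: B_def abs_le_iff)
    qed
    then show ?thesis by simp
  qed
  have linl: "linear (\<lambda>x. B x y)" for y
    by (intro linearI add) (simp add: hom)
  define P :: "real^'m^'m" where "P = (\<chi> i j. B (axis i 1) (axis j 1))"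
  have expand: "B x y = (\<Sum>i\<in>UNIV. x $ i * B (axis i 1) y)" for x y
  proof -
    have "B x y = B (\<Sum>i\<in>UNIV. x $ i *\<^sub>R axis i 1) y"
      using basis_expansion[of x] by (simp add: scalar_mult_eq_scaleR)
    also have "\<dots> = (\<Sum>i\<in>UNIV. x $ i * B (axis i 1) y)"
      by (simp add: linear_sum[OF linl] hom)
    finally show ?thesis .
  qed
  have "V x = quad_form P x" for x
  proof -
    have "V x = (\<Sum>i\<in>UNIV. x $ i * B (axis i 1) x)"
      using expand[of x x] diag by simp
    also have "\<dots> = (\<Sum>i\<in>UNIV. x $ i * (\<Sum>j\<in>UNIV. x $ j * P $ i $ j))"
    proof (intro sum.cong refl arg_cong[where f = "\<lambda>s. x $ _ * s"])
      fix i
      show "B (axis i 1) x = (\<Sum>j\<in>UNIV. x $ j * P $ i $ j)"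
        unfolding comm[of "axis i 1" x] expand[of x] by (simp add: P_def comm[of _ "axis i 1"])
    qed
    also have "\<dots> = quad_form P x"
      by (simp add: quad_form_alt sum_distrib_left algebra_simps)
    finally show ?thesis .
  qed
  moreover have "transpose P = P"
    by (simp add: P_def transpose_def vec_eq_iff) (metis comm)
  ultimately show ?thesis using that by blast
qed

subsection \<open>The available storage\<close>

locale scalar_system =
  fixes A :: "real^'m^'m" and \<beta> c :: "real^'m"
begin

abbreviation free_response :: "nat \<Rightarrow> real^'m \<Rightarrow> real^'m" where
  "free_response n \<equiv> ((*v) A) ^^ n"

primrec traj :: "real^'m \<Rightarrow> (nat \<Rightarrow> real) \<Rightarrow> nat \<Rightarrow> real^'m" where
  "traj x w 0 = x"
| "traj x w (Suc k) = A *v traj x w k + w k *\<^sub>R \<beta>"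

definition impulse_response :: "nat \<Rightarrow> real" where
  "impulse_response n = inner c (free_response n \<beta>)"

text \<open>With \<open>\<alpha> = 2 * (1 - \<delta>)\<close> the summand is the right-hand side of
  \<open>dissipative\<close>: this is the energy supplied over \<open>N\<close> steps, and its
  negative the energy extracted.\<close>

definition cost :: "real \<Rightarrow> nat \<Rightarrow> real^'m \<Rightarrow> (nat \<Rightarrow> real) \<Rightarrow> real" where
  "cost \<alpha> N x w = (\<Sum>k<N. w k * (\<alpha> * w k - 2 * inner c (traj x w k)))"

lemma traj_add: "traj (x + y) (\<lambda>k. u k + v k) n = traj x u n + traj y v n"
  by (induction n) (simp_all add: matrix_vector_right_distrib scaleR_add_left)

lemma traj_scale: "traj (t *\<^sub>R x) (\<lambda>k. t * u k) n = t *\<^sub>R traj x u n"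
  by (induction n) (simp_all add: matrix_vector_mult_scaleR scaleR_add_right)

lemma traj_diff: "traj (x - y) (\<lambda>k. u k - v k) n = traj x u n - traj y v n"
  using traj_add[of x "(-1) *\<^sub>R y" u "\<lambda>k. -1 * v k" n] traj_scale[of "-1" y v n] by simp

lemma traj_cong: "(\<And>k. k < n \<Longrightarrow> u k = v k) \<Longrightarrow> traj x u n = traj x v n"
  by (induction n) simp_all

lemma traj_append:
  "traj x (\<lambda>k. if k < n then u k else v (k - n)) (n + k) = traj (traj x u n) v k"
proof (induction k)
  case 0
  show ?case by (simp, rule traj_cong, simp)
qed simp

lemma traj_zero_conv:
  "traj 0 w n = (\<Sum>j<n. w j *\<^sub>R free_response (n - 1 - j) \<beta>)"
proof (induction n)
  case (Suc n)
  have "A *v (\<Sum>j<n. w j *\<^sub>R free_response (n - 1 - j) \<beta>) = (\<Sum>j<n. w j *\<^sub>R free_response (n - j) \<beta>)"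
    unfolding linear_sum[OF matrix_vector_mul_linear]
  proof (rule sum.cong)
    fix j assume "j \<in> {..<n}"
    then have "n - j = Suc (n - 1 - j)" by auto
    then show "A *v (w j *\<^sub>R free_response (n - 1 - j) \<beta>) = w j *\<^sub>R free_response (n - j) \<beta>"
      by (simp add: matrix_vector_mult_scaleR)
  qed simp
  then show ?case by (simp add: Suc.IH)
qed simp

lemma cost_cong: "(\<And>k. k < N \<Longrightarrow> u k = v k) \<Longrightarrow> cost \<alpha> N x u = cost \<alpha> N x v"
  unfolding cost_def by (intro sum.cong refl) (metis lessThan_iff order_less_trans traj_cong)

text \<open>Additivity under concatenated inputs is the source of both the finiteness of the storage
  and its dynamic programming inequality.\<close>

lemma cost_append:
  "cost \<alpha> (M + N) x (\<lambda>k. if k < M then u k else v (k - M)) = cost \<alpha> M x u + cost \<alpha> N (traj x u M) v"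
proof -
  let ?w = "\<lambda>k. if k < M then u k else v (k - M)"
  have "cost \<alpha> (M + n) x ?w = cost \<alpha> M x ?w + cost \<alpha> n (traj x u M) v" for n
    by (induction n) (simp_all add: cost_def traj_append)
  moreover have "cost \<alpha> M x ?w = cost \<alpha> M x u" by (rule cost_cong) simp
  ultimately show ?thesis by simp
qed

text \<open>Zero input supplies nothing, so inputs of different lengths can be brought to a common
  horizon.\<close>

lemma cost_pad:
  "cost \<alpha> (M + N) x (\<lambda>k. if k < M then u k else 0) = cost \<alpha> M x u"
  using cost_append[of \<alpha> M N x u "\<lambda>_. 0"] by (simp add: cost_def)

lemma cost_Suc:
  "cost \<alpha> (Suc N) x (\<lambda>k. case k of 0 \<Rightarrow> v | Suc j \<Rightarrow> w j)
     = v * (\<alpha> * v - 2 * inner c x) + cost \<alpha> N (A *v x + v *\<^sub>R \<beta>) w"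
proof -
  have "(\<lambda>k. case k of 0 \<Rightarrow> v | Suc j \<Rightarrow> w j) = (\<lambda>k. if k < 1 then v else w (k - 1))"
    by (auto simp: fun_eq_iff split: nat.split)
  then show ?thesis
    using cost_append[of \<alpha> 1 N x "\<lambda>_. v" w] by (simp add: cost_def)
qed

lemma cost_parallelogram:
  "cost \<alpha> N (x + y) (\<lambda>k. u k + v k) + cost \<alpha> N (x - y) (\<lambda>k. u k - v k)
     = 2 * cost \<alpha> N x u + 2 * cost \<alpha> N y v"
  by (simp add: cost_def traj_add traj_diff sum.distrib[symmetric] sum_distrib_left
      inner_add_right inner_diff_right algebra_simps)

lemma cost_scale: "cost \<alpha> N (t *\<^sub>R x) (\<lambda>k. t * u k) = t\<^sup>2 * cost \<alpha> N x u"
  by (simp add: cost_def traj_scale sum_distrib_left power2_eq_square algebra_simps)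

lemma storage_exists:
  assumes pos: "\<And>N w. 0 \<le> cost \<alpha> N 0 w"
    and reach: "\<And>x. \<exists>N w. traj 0 w N = x"
    and obs: "\<And>x. (\<And>k. inner c (free_response k x) = 0) \<Longrightarrow> x = 0"
  obtains P where "sym_pos_def P"
    "\<And>x v. quad_form P (A *v x + v *\<^sub>R \<beta>) - quad_form P x \<le> v * (\<alpha> * v - 2 * inner c x)"
proof -
  define V where "V x = (SUP p. - cost \<alpha> (fst p) x (snd p))" for x
  \<comment> \<open>Reach \<open>x\<close> from \<open>0\<close> with \<open>u\<close>, then extract
    with \<open>w\<close>: the total cost is nonnegative, so the extracted energy is at most the
    cost of \<open>u\<close>.\<close>
  have bdd: "bdd_above (range (\<lambda>p. - cost \<alpha> (fst p) x (snd p)))" for x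
  proof -
    obtain M u where u: "traj 0 u M = x" using reach by blast
    have "- cost \<alpha> N x w \<le> cost \<alpha> M 0 u" for N w
      using pos[of "M + N" "\<lambda>k. if k < M then u k else w (k - M)"]
      by (simp add: cost_append u)
    then show ?thesis by (intro bdd_aboveI2) auto
  qed
  have upper: "- cost \<alpha> N x w \<le> V x" for N x w
    unfolding V_def using cSUP_upper[OF _ bdd, of "(N, w)"] by simp
  have least: "V x \<le> B" if "\<And>N w. - cost \<alpha> N x w \<le> B" for x B
    unfolding V_def by (rule cSUP_least) (use that in auto)
  have nonneg: "0 \<le> V x" for x
    using upper[of 0 x undefined] by (simp add: cost_def)
  have V0: "V 0 = 0"
    using nonneg[of 0] least[of 0 0] pos by fastforce
  have scale_le: "t\<^sup>2 * V x \<le> V (t *\<^sub>R x)" for t x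
  proof (cases "t = 0")
    case False
    have "V x \<le> V (t *\<^sub>R x) / t\<^sup>2"
    proof (rule least)
      fix N w
      have "- (t\<^sup>2 * cost \<alpha> N x w) \<le> V (t *\<^sub>R x)"
        using upper[of N "t *\<^sub>R x" "\<lambda>k. t * w k"] by (simp add: cost_scale)
      then show "- cost \<alpha> N x w \<le> V (t *\<^sub>R x) / t\<^sup>2"
        using False by (simp add: field_simps)
    qed
    then show ?thesis using False by (simp add: field_simps)
  qed (simp add: V0)
  have scale: "V (t *\<^sub>R x) = t\<^sup>2 * V x" for t x
  proof (cases "t = 0")
    case False
    have "(1 / t)\<^sup>2 * V (t *\<^sub>R x) \<le> V x"
      using scale_le[of "1 / t" "t *\<^sub>R x"] False by simp
    then have "V (t *\<^sub>R x) \<le> t\<^sup>2 * V x"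
      using False by (simp add: field_simps)
    then show ?thesis using scale_le[of t x] by linarith
  qed (simp add: V0)
  have par_le: "V (x + y) + V (x - y) \<le> 2 * V x + 2 * V y" for x y
  proof -
    \<comment> \<open>Inputs \<open>w\<close> at \<open>x + y\<close> and \<open>z\<close> at
      \<open>x - y\<close> are padded to the horizon \<open>N + M\<close>; half their sum is used at
      \<open>x\<close> and half their difference at \<open>y\<close>.\<close>
    have *: "- cost \<alpha> N (x + y) w + - cost \<alpha> M (x - y) z \<le> 2 * V x + 2 * V y" for N w M z
    proof -
      define w' where "w' k = (if k < N then w k else 0)" for k
      define z' where "z' k = (if k < M then z k else 0)" for k
      define u where "u k = (w' k + z' k) / 2" for k
      define v where "v k = (w' k - z' k) / 2" for k
      have "(\<lambda>k. u k + v k) = w'" "(\<lambda>k. u k - v k) = z'"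
        by (simp_all add: u_def v_def fun_eq_iff field_simps)
      moreover have "cost \<alpha> (N + M) (x + y) w' = cost \<alpha> N (x + y) w"
        unfolding w'_def by (rule cost_pad)
      moreover have "cost \<alpha> (N + M) (x - y) z' = cost \<alpha> M (x - y) z"
        unfolding z'_def add.commute[of N M] by (rule cost_pad)
      ultimately have "cost \<alpha> N (x + y) w + cost \<alpha> M (x - y) z = 2 * cost \<alpha> (N + M) x u + 2 * cost \<alpha> (N + M) y v"
        using cost_parallelogram[of \<alpha> "N + M" x y u v] by simp
      then show ?thesis
        using upper[of "N + M" x u] upper[of "N + M" y v] by linarith
    qed
    have "V (x + y) \<le> 2 * V x + 2 * V y - V (x - y)"
    proof (rule least)
      fix N w
      have "V (x - y) \<le> 2 * V x + 2 * V y + cost \<alpha> N (x + y) w"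
        by (rule least) (use *[of N w] in \<open>simp add: algebra_simps\<close>)
      then show "- cost \<alpha> N (x + y) w \<le> 2 * V x + 2 * V y - V (x - y)" by linarith
    qed
    then show ?thesis by linarith
  qed
  \<comment> \<open>For equality, \<open>par_le\<close> is applied to \<open>x + y\<close> and
    \<open>x - y\<close>, whose sum and difference are \<open>2 x\<close> and \<open>2 y\<close>;
    homogeneity removes the factor.\<close>
  have par: "V (x + y) + V (x - y) = 2 * V x + 2 * V y" for x y
  proof -
    have "V (2 *\<^sub>R x) + V (2 *\<^sub>R y) \<le> 2 * V (x + y) + 2 * V (x - y)"
      using par_le[of "x + y" "x - y"] by (simp add: scaleR_2)
    then show ?thesis using par_le[of x y] by (simp add: scale)
  qed
  obtain P where P: "transpose P = P" "\<And>x. V x = quad_form P x"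
    using parallelogram_imp_quad_form[OF par nonneg scale] by blast
  \<comment> \<open>Dynamic programming: any input from the successor state, preceded by
    \<open>v\<close>, is an input from \<open>x\<close>.\<close>
  have diss: "V (A *v x + v *\<^sub>R \<beta>) \<le> V x + v * (\<alpha> * v - 2 * inner c x)" for x v
  proof (rule least)
    fix N w
    show "- cost \<alpha> N (A *v x + v *\<^sub>R \<beta>) w \<le> V x + v * (\<alpha> * v - 2 * inner c x)"
      using upper[of "Suc N" x "\<lambda>k. case k of 0 \<Rightarrow> v | Suc j \<Rightarrow> w j"] by (simp add: cost_Suc)
  qed
  have zero_output: "inner c x = 0" if "V x = 0" for x
  proof (rule ccontr)
    assume nz: "inner c x \<noteq> 0"
    have ge: "0 \<le> v * (\<alpha> * v - 2 * inner c x)" for v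
      using diss[of x v] nonneg[of "A *v x + v *\<^sub>R \<beta>"] that by linarith
    \<comment> \<open>\<open>s\<close> exceeds \<open>\<bar>\<alpha>\<bar>\<close>, so at
      \<open>v = inner c x / s\<close> the linear term of the supply beats the quadratic one,
      whatever the sign of \<open>\<alpha>\<close>.\<close>
    define s where "s = \<bar>\<alpha>\<bar> + 1"
    have s: "0 < s" "\<alpha> / s - 2 < 0" by (auto simp: s_def field_simps)
    define v where "v = inner c x / s"
    have "v * (\<alpha> * v - 2 * inner c x) = (inner c x)\<^sup>2 / s * (\<alpha> / s - 2)"
      using s(1) by (simp add: v_def power2_eq_square field_simps)
    also have "\<dots> < 0" using nz s by (intro mult_pos_neg) simp_all
    finally have "v * (\<alpha> * v - 2 * inner c x) < 0" .
    then show False using ge[of v] by linarith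
  qed
  have definite: "x = 0" if "V x = 0" for x
  proof (rule obs)
    fix k
    \<comment> \<open>With zero input the storage does not increase, so it stays zero along the free
      motion.\<close>
    have "V (free_response k x) = 0"
    proof (induction k)
      case (Suc k)
      then show ?case
        using diss[of "free_response k x" 0] nonneg[of "A *v free_response k x"] by simp
    qed (simp add: that)
    then show "inner c (free_response k x) = 0" by (rule zero_output)
  qed
  have "sym_pos_def P"
    unfolding sym_pos_def_def using P definite nonneg by (metis order_le_less)
  moreover have "quad_form P (A *v x + v *\<^sub>R \<beta>) - quad_form P x \<le> v * (\<alpha> * v - 2 * inner c x)" for x v
    using diss[of x v] by (simp add: P(2))
  ultimately show ?thesis using that by blast
qed

end

subsection \<open>Nonnegative cost from the frequency inequality\<close>

lemma sum_swap3:
  "(\<Sum>i\<in>I. \<Sum>j\<in>J. \<Sum>k\<in>K. f i j k) = (\<Sum>j\<in>J. \<Sum>k\<in>K. \<Sum>i\<in>I. f i j k)"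
proof -
  have "(\<Sum>i\<in>I. \<Sum>j\<in>J. \<Sum>k\<in>K. f i j k) = (\<Sum>j\<in>J. \<Sum>i\<in>I. \<Sum>k\<in>K. f i j k)"
    by (rule sum.swap)
  also have "\<dots> = (\<Sum>j\<in>J. \<Sum>k\<in>K. \<Sum>i\<in>I. f i j k)"
    by (intro sum.cong refl sum.swap)
  finally show ?thesis .
qed

text \<open>Real part of a geometric sum over the powers of an \<open>M\<close>-th root of unity
  \<open>z\<close>. The bound on \<open>d\<close> excludes aliasing: \<open>z = 1\<close> only for
  \<open>d = 0\<close>.\<close>

lemma sum_cos_roots_of_unity:
  assumes "\<bar>d\<bar> < int M"
  shows "(\<Sum>t<M. cos (of_int d * (2 * pi * real t / real M))) = (if d = 0 then real M else 0)"
proof (cases "d = 0")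
  case False
  have "0 < M" using assms by auto
  define z where "z = cis (2 * pi * of_int d / real M)"
  have "z \<noteq> 1"
  proof
    assume "z = 1"
    then have "cos (2 * pi * of_int d / real M) = 1" by (auto simp: z_def complex_eq_iff)
    then obtain k :: int where k: "2 * pi * of_int d / real M = of_int k * 2 * pi"
      unfolding cos_one_2pi_int by auto
    then have "of_int d = (of_int k * of_nat M :: real)" using \<open>0 < M\<close> by (simp add: field_simps)
    then have "d = k * int M" by (metis of_int_eq_iff of_int_mult of_int_of_nat_eq)
    with assms have "\<bar>k\<bar> * int M < 1 * int M" by (simp add: abs_mult)
    then have "k = 0" using \<open>0 < M\<close> by (simp only: mult_less_cancel_right) auto
    with \<open>d = k * int M\<close> False show False by simp
  qed
  have "z ^ M = 1"
    using \<open>0 < M\<close> cis_multiple_2pi[of "of_int d"] by (simp add: z_def Complex.DeMoivre)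
  then have "(\<Sum>t<M. z ^ t) = 0"
    using \<open>z \<noteq> 1\<close> by (simp add: geometric_sum)
  then have "Re (\<Sum>t<M. z ^ t) = 0" by simp
  then show ?thesis
    using False by (simp add: z_def Complex.DeMoivre mult_ac)
qed simp

context scalar_system
begin

text \<open>From rest the cost is a Toeplitz form in \<open>w\<close> with symbol
  \<open>\<alpha> - 2 \<Sum>n. g n cos ((n + 1) \<theta>)\<close>, where \<open>g\<close> is the
  impulse response.\<close>

lemma cost_zero_conv:
  "cost \<alpha> N 0 w = \<alpha> * (\<Sum>k<N. (w k)\<^sup>2)
     - 2 * (\<Sum>k<N. \<Sum>j<k. impulse_response (k - 1 - j) * (w k * w j))"
proof -
  have "w k * (\<alpha> * w k - 2 * inner c (traj 0 w k))
      = \<alpha> * (w k)\<^sup>2 - 2 * (\<Sum>j<k. impulse_response (k - 1 - j) * (w k * w j))" for k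
    by (simp add: traj_zero_conv inner_sum_right impulse_response_def sum_distrib_left
        power2_eq_square algebra_simps)
  then show ?thesis by (simp add: cost_def sum_subtractf sum_distrib_left)
qed

text \<open>The frequency inequality for the truncated impulse response, multiplied by
  \<open>\<bar>\<Sum>\<^sub>k w\<^sub>k e\<^sup>i\<^sup>k\<^sup>\<theta>\<bar>\<^sup>2\<close> and averaged over sufficiently many roots of unity, is the Toeplitz form of the
  cost: the truncation makes the discrete average exact.\<close>

lemma cost_zero_nonneg:
  assumes sum: "summable (\<lambda>n. \<bar>impulse_response n\<bar>)"
    and freq: "\<And>\<theta>. \<theta> \<in> {0..2 * pi} \<Longrightarrow> 2 * (\<Sum>n. impulse_response n * cos (real (Suc n) * \<theta>)) \<le> \<alpha>"
  shows "0 \<le> cost \<alpha> N 0 w"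
proof -
  let ?g = impulse_response
  define W where "W = (\<Sum>k<N. (w k)\<^sup>2)"
  \<comment> \<open>\<open>\<epsilon>\<close> bounds the tail of the impulse response discarded
    below; the resulting error is proportional to the input energy \<open>W\<close>.\<close>
  have approx: "0 \<le> cost \<alpha> N 0 w + 2 * \<epsilon> * W" if eps: "0 < \<epsilon>" for \<epsilon>
  proof -
    obtain K0 where K0: "\<And>n. n \<ge> K0 \<Longrightarrow> (\<Sum>i. \<bar>?g (i + n)\<bar>) < \<epsilon>"
      using suminf_exist_split[OF eps sum]
      by (auto simp: suminf_nonneg summable_iff_shift[of "\<lambda>n. \<bar>?g n\<bar>"] sum)
    \<comment> \<open>\<open>K \<ge> N\<close> keeps every lag that occurs in the cost.\<close>
    define K where "K = K0 + N"
    have K: "(\<Sum>i. \<bar>?g (i + K)\<bar>) < \<epsilon>" "N \<le> K" using K0 by (auto simp: K_def)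
    \<comment> \<open>\<open>M\<close> exceeds every frequency
      \<open>\<bar>k - j\<bar> + n + 1\<close> with \<open>n < K\<close>, so averages over
      \<open>M\<close> points are exact.\<close>
    define M where "M = Suc (K + N)"
    have "0 < M" by (simp add: M_def)
    define \<theta> where "\<theta> t = 2 * pi * real t / real M" for t
    \<comment> \<open>\<open>q x\<close> is the squared modulus of
      \<open>\<Sum>k<N. w k e^(i k x)\<close>.\<close>
    define q where "q x = (\<Sum>k<N. \<Sum>j<N. w k * w j * cos (of_int (int k - int j) * x))" for x
    have q_nonneg: "0 \<le> q x" for x
    proof -
      have "q x = (\<Sum>k<N. \<Sum>j<N. (w k * cos (real k * x)) * (w j * cos (real j * x)))
          + (\<Sum>k<N. \<Sum>j<N. (w k * sin (real k * x)) * (w j * sin (real j * x)))"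
        by (simp add: q_def sum.distrib[symmetric] left_diff_distrib cos_diff algebra_simps)
      also have "\<dots> = (\<Sum>k<N. w k * cos (real k * x))\<^sup>2 + (\<Sum>k<N. w k * sin (real k * x))\<^sup>2"
        by (simp add: power2_eq_square sum_product)
      finally show ?thesis by simp
    qed
    have trunc: "0 \<le> \<alpha> + 2 * \<epsilon> - 2 * (\<Sum>n<K. ?g n * cos (real (Suc n) * x))" if x: "x \<in> {0..2 * pi}" for x
    proof -
      have s: "summable (\<lambda>n. \<bar>?g n * cos (real (Suc n) * x)\<bar>)"
        by (rule summable_comparison_test'[OF sum]) (simp add: abs_mult mult_left_le)
      have tail: "\<bar>\<Sum>n. ?g (n + K) * cos (real (Suc (n + K)) * x)\<bar> \<le> (\<Sum>n. \<bar>?g (n + K)\<bar>)"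
      proof -
        have s': "summable (\<lambda>n. \<bar>?g (n + K) * cos (real (Suc (n + K)) * x)\<bar>)"
          using s summable_iff_shift[of "\<lambda>n. \<bar>?g n * cos (real (Suc n) * x)\<bar>" K] by simp
        have "\<bar>\<Sum>n. ?g (n + K) * cos (real (Suc (n + K)) * x)\<bar>
            \<le> (\<Sum>n. \<bar>?g (n + K) * cos (real (Suc (n + K)) * x)\<bar>)"
          by (rule summable_rabs[OF s'])
        also have "\<dots> \<le> (\<Sum>n. \<bar>?g (n + K)\<bar>)"
          by (intro suminf_le s')
            (use sum in \<open>simp_all add: abs_mult mult_left_le summable_iff_shift[of "\<lambda>n. \<bar>?g n\<bar>" K]\<close>)
        finally show ?thesis .
      qed
      have "(\<Sum>n. ?g n * cos (real (Suc n) * x)) = (\<Sum>n. ?g (n + K) * cos (real (Suc (n + K)) * x))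
          + (\<Sum>n<K. ?g n * cos (real (Suc n) * x))"
        by (rule suminf_split_initial_segment[OF summable_rabs_cancel[OF s]])
      then show ?thesis using freq[OF x] tail K(1) by linarith
    qed
    have avg: "(\<Sum>t<M. cos (of_int d * \<theta> t)) = (if d = 0 then real M else 0)" if "\<bar>d\<bar> < int M" for d
      unfolding \<theta>_def using sum_cos_roots_of_unity[OF that] by simp
    have term0: "(\<Sum>t<M. q (\<theta> t)) = real M * W"
    proof -
      have "(\<Sum>t<M. q (\<theta> t)) = (\<Sum>k<N. \<Sum>j<N. w k * w j * (\<Sum>t<M. cos (of_int (int k - int j) * \<theta> t)))"
        unfolding q_def sum_distrib_left
        by (rule sum_swap3)
      also have "\<dots> = (\<Sum>k<N. \<Sum>j<N. if k = j then real M * (w k)\<^sup>2 else 0)"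
        by (intro sum.cong refl, subst avg) (auto simp: M_def power2_eq_square)
      finally show ?thesis by (simp add: W_def sum_distrib_left)
    qed
    \<comment> \<open>The product formula for cosines leaves the lags \<open>k - j = n + 1\<close>
      and \<open>j - k = n + 1\<close>, which contribute equally by symmetry.\<close>
    have term1: "(\<Sum>t<M. cos (real (Suc n) * \<theta> t) * q (\<theta> t))
        = real M * (\<Sum>k<N. \<Sum>j<N. if k = j + Suc n then w k * w j else 0)" if n: "n < K" for n
    proof -
      have cc: "cos (real (Suc n) * x) * cos (of_int (int k - int j) * x)
          = (cos (of_int (int k - int j - int (Suc n)) * x) + cos (of_int (int j - int k - int (Suc n)) * x)) / 2" for k j x
        using cos_minus[of "of_int (int k - int j - int (Suc n)) * x"]
          cos_minus[of "of_int (int j - int k - int (Suc n)) * x"]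
        by (simp add: cos_times_cos algebra_simps)
      have "(\<Sum>t<M. cos (real (Suc n) * \<theta> t) * q (\<theta> t))
          = (\<Sum>k<N. \<Sum>j<N. w k * w j * (\<Sum>t<M. cos (real (Suc n) * \<theta> t) * cos (of_int (int k - int j) * \<theta> t)))"
        unfolding q_def sum_distrib_left
        by (rule trans[OF sum_swap3]) (simp add: mult_ac)
      also have "\<dots> = (\<Sum>k<N. \<Sum>j<N. (if k = j + Suc n then real M / 2 * (w k * w j) else 0)
          + (if j = k + Suc n then real M / 2 * (w k * w j) else 0))"
      proof (intro sum.cong refl)
        fix k j assume "k \<in> {..<N}" "j \<in> {..<N}"
        then have "\<bar>int k - int j - int (Suc n)\<bar> < int M" "\<bar>int j - int k - int (Suc n)\<bar> < int M"
          using n by (auto simp: M_def)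
        then have "(\<Sum>t<M. cos (real (Suc n) * \<theta> t) * cos (of_int (int k - int j) * \<theta> t))
          = ((if int k - int j - int (Suc n) = 0 then real M else 0)
             + (if int j - int k - int (Suc n) = 0 then real M else 0)) / 2"
          unfolding cc sum_divide_distrib[symmetric] sum.distrib by (simp only: avg)
        then show "w k * w j * (\<Sum>t<M. cos (real (Suc n) * \<theta> t) * cos (of_int (int k - int j) * \<theta> t))
          = (if k = j + Suc n then real M / 2 * (w k * w j) else 0)
          + (if j = k + Suc n then real M / 2 * (w k * w j) else 0)"
          by auto
      qed
      also have "\<dots> = (\<Sum>k<N. \<Sum>j<N. if k = j + Suc n then real M / 2 * (w k * w j) else 0)
          + (\<Sum>k<N. \<Sum>j<N. if j = k + Suc n then real M / 2 * (w k * w j) else 0)"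
        by (simp only: sum.distrib)
      also have "(\<Sum>k<N. \<Sum>j<N. if j = k + Suc n then real M / 2 * (w k * w j) else 0)
          = (\<Sum>k<N. \<Sum>j<N. if k = j + Suc n then real M / 2 * (w k * w j) else 0)"
        by (subst sum.swap) (simp only: mult.commute)
      finally show ?thesis by (simp add: sum_distrib_left if_distrib[of "\<lambda>x. _ * x"] sum.distrib[symmetric] cong: if_cong)
    qed
    have toeplitz: "(\<Sum>n<K. ?g n * (\<Sum>k<N. \<Sum>j<N. if k = j + Suc n then w k * w j else 0))
        = (\<Sum>k<N. \<Sum>j<k. ?g (k - 1 - j) * (w k * w j))"
    proof -
      have "(\<Sum>n<K. ?g n * (\<Sum>k<N. \<Sum>j<N. if k = j + Suc n then w k * w j else 0))
          = (\<Sum>k<N. \<Sum>j<N. \<Sum>n<K. ?g n * (if k = j + Suc n then w k * w j else 0))"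
        unfolding sum_distrib_left by (rule sum_swap3)
      also have "\<dots> = (\<Sum>k<N. \<Sum>j<N. if j < k then ?g (k - 1 - j) * (w k * w j) else 0)"
      proof (intro sum.cong refl)
        fix k j assume kj: "k \<in> {..<N}" "j \<in> {..<N}"
        \<comment> \<open>The guard \<open>j < k\<close> matters: for \<open>j \<ge> k\<close> the
          truncated difference \<open>k - 1 - j\<close> is \<open>0\<close> and would select a
          spurious term.\<close>
        have "(\<Sum>n<K. ?g n * (if k = j + Suc n then w k * w j else 0))
            = (\<Sum>n<K. if n = k - 1 - j then (if j < k then ?g n * (w k * w j) else 0) else 0)"
          by (intro sum.cong refl) auto
        also have "\<dots> = (if j < k then ?g (k - 1 - j) * (w k * w j) else 0)"
          using kj K(2) by (subst sum.delta) auto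
        finally show "(\<Sum>n<K. ?g n * (if k = j + Suc n then w k * w j else 0))
            = (if j < k then ?g (k - 1 - j) * (w k * w j) else 0)" .
      qed
      also have "\<dots> = (\<Sum>k<N. \<Sum>j<k. ?g (k - 1 - j) * (w k * w j))"
      proof (rule sum.cong[OF refl])
        fix k assume "k \<in> {..<N}"
        then have "{j \<in> {..<N}. j < k} = {..<k}" by auto
        then show "(\<Sum>j<N. if j < k then ?g (k - 1 - j) * (w k * w j) else 0) = (\<Sum>j<k. ?g (k - 1 - j) * (w k * w j))"
          unfolding sum.inter_filter[OF finite_lessThan, symmetric] by simp
      qed
      finally show ?thesis .
    qed
    have "0 \<le> (\<Sum>t<M. (\<alpha> + 2 * \<epsilon> - 2 * (\<Sum>n<K. ?g n * cos (real (Suc n) * \<theta> t))) * q (\<theta> t))"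
    proof (intro sum_nonneg mult_nonneg_nonneg[OF trunc q_nonneg])
      fix t assume "t \<in> {..<M}"
      then show "\<theta> t \<in> {0..2 * pi}" by (simp add: \<theta>_def divide_simps)
    qed
    also have "\<dots> = (\<alpha> + 2 * \<epsilon>) * (\<Sum>t<M. q (\<theta> t))
        - 2 * (\<Sum>n<K. ?g n * (\<Sum>t<M. cos (real (Suc n) * \<theta> t) * q (\<theta> t)))"
    proof -
      have "(\<Sum>t<M. (\<Sum>n<K. ?g n * cos (real (Suc n) * \<theta> t)) * q (\<theta> t))
          = (\<Sum>n<K. ?g n * (\<Sum>t<M. cos (real (Suc n) * \<theta> t) * q (\<theta> t)))"
        unfolding sum_distrib_left sum_distrib_right by (rule trans[OF sum.swap]) (simp add: mult_ac)
      then show ?thesis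
        by (simp add: left_diff_distrib sum_subtractf sum_distrib_left[symmetric] mult.assoc)
    qed
    also have "\<dots> = real M * ((\<alpha> + 2 * \<epsilon>) * W - 2 * (\<Sum>n<K. ?g n * (\<Sum>k<N. \<Sum>j<N. if k = j + Suc n then w k * w j else 0)))"
    proof -
      have "(\<Sum>n<K. ?g n * (\<Sum>t<M. cos (real (Suc n) * \<theta> t) * q (\<theta> t)))
          = real M * (\<Sum>n<K. ?g n * (\<Sum>k<N. \<Sum>j<N. if k = j + Suc n then w k * w j else 0))"
        unfolding sum_distrib_left[of "real M"]
        by (rule sum.cong[OF refl]) (simp only: lessThan_iff term1 mult.left_commute)
      then show ?thesis unfolding term0 by (simp add: algebra_simps)
    qed
    also have "\<dots> = real M * (cost \<alpha> N 0 w + 2 * \<epsilon> * W)"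
      unfolding toeplitz cost_zero_conv W_def by (simp add: algebra_simps)
    finally show ?thesis using \<open>0 < M\<close> by (simp add: zero_le_mult_iff)
  qed
  show ?thesis
  proof (rule ccontr)
    assume neg: "\<not> 0 \<le> cost \<alpha> N 0 w"
    have "0 \<le> W" by (simp add: W_def sum_nonneg)
    define s where "s = W + 1"
    have "0 < s" "W \<le> s" using \<open>0 \<le> W\<close> by (simp_all add: s_def)
    \<comment> \<open>This makes the error \<open>2 * \<epsilon> * W\<close> at most half the
      modulus of the supposedly negative cost; \<open>s = W + 1\<close> avoids division by
      zero.\<close>
    define \<epsilon> where "\<epsilon> = - cost \<alpha> N 0 w / (4 * s)"
    have "0 < \<epsilon>"
      unfolding \<epsilon>_def using neg \<open>0 < s\<close> by (intro divide_pos_pos) simp_all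
    moreover have "4 * (\<epsilon> * s) = - cost \<alpha> N 0 w"
      using \<open>0 < s\<close> by (simp add: \<epsilon>_def)
    moreover have "\<epsilon> * W \<le> \<epsilon> * s" using \<open>0 < \<epsilon>\<close> \<open>W \<le> s\<close> by simp
    moreover have "0 \<le> cost \<alpha> N 0 w + 2 * (\<epsilon> * W)"
      using approx[OF \<open>0 < \<epsilon>\<close>] by (simp only: mult.assoc)
    ultimately show False using neg by linarith
  qed
qed

end

subsection \<open>The transfer function and the impulse response\<close>

lemma matrix_inv_eqI:
  fixes M :: "'a::semiring_1^'n^'m"
  assumes "M ** Z = mat 1" "Z ** M = mat 1"
  shows "matrix_inv M = Z"
  unfolding matrix_inv_def
proof (rule some_equality)
  fix Y assume Y: "M ** Y = mat 1 \<and> Y ** M = mat 1"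
  have "Y = Y ** (M ** Z)" by (simp add: assms(1))
  also have "\<dots> = (Y ** M) ** Z" by (rule matrix_mul_assoc)
  finally show "Y = Z" using Y by simp
qed (use assms in simp)

lemma holomorphic_on_det:
  assumes "\<And>i j. (\<lambda>u. M u $ i $ j) holomorphic_on S"
  shows "(\<lambda>u. det (M u)) holomorphic_on S"
  unfolding det_def by (intro holomorphic_intros assms)

section \<open>The pencil I - u A, its Neumann series and Cramer's rule\<close>

context scalar_system
begin

text \<open>For \<open>z = 1 / u\<close> one has \<open>z I - A = (1 / u) (I - u A)\<close>; the
  pencil is polynomial in \<open>u\<close> and covers \<open>z\<close> at infinity as
  \<open>u = 0\<close>.\<close>

definition pencil :: "complex \<Rightarrow> complex^'m^'m" where
  "pencil u = (\<chi> i j. (if i = j then 1 else 0) - u * of_real (A $ i $ j))"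

text \<open>By Cramer's rule this is the numerator \<open>c adj(I - u A) \<beta>\<close> of
  \<open>c (I - u A)^(-1) \<beta>\<close>.\<close>

definition pencil_num :: "complex \<Rightarrow> complex" where
  "pencil_num u = (\<Sum>k\<in>UNIV. of_real (c $ k) *
     det (\<chi> i j. if j = k then of_real (\<beta> $ i) else pencil u $ i $ j))"

abbreviation response_series :: "real^'m \<Rightarrow> complex \<Rightarrow> complex^'m" where
  "response_series v u \<equiv> (\<chi> i. \<Sum>n. of_real (free_response n v $ i) * u ^ n)"

text \<open>Entrywise convergence of the Neumann series of \<open>(I - u A)^(-1)\<close>.\<close>

definition responses_summable :: "complex \<Rightarrow> bool" where
  "responses_summable u \<longleftrightarrow>
     (\<forall>v i. summable (\<lambda>n. of_real (free_response n v $ i) * u ^ n :: complex))"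

text \<open>The Neumann series telescopes: \<open>u A\<close> maps each term to the next, so only
  the zeroth term \<open>v\<close> remains.\<close>

lemma pencil_mult_response_series:
  assumes "responses_summable u"
  shows "pencil u *v response_series v u = (\<chi> i. of_real (v $ i))"
proof -
  have s: "summable (\<lambda>n. of_real (free_response n v $ i) * u ^ n)" for i
    using assms by (auto simp: responses_summable_def)
  have "(pencil u *v response_series v u) $ i = of_real (v $ i)" for i
  proof -
    let ?y = "\<lambda>j. \<Sum>n. of_real (free_response n v $ j) * u ^ n"
    have "(\<Sum>j\<in>UNIV. of_real (A $ i $ j) * ?y j)
        = (\<Sum>j\<in>UNIV. \<Sum>n. of_real (A $ i $ j) * (of_real (free_response n v $ j) * u ^ n))"
      by (simp only: suminf_mult[OF s])
    also have "\<dots> = (\<Sum>n. \<Sum>j\<in>UNIV. of_real (A $ i $ j) * (of_real (free_response n v $ j) * u ^ n))"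
      by (intro suminf_sum[symmetric] summable_mult s)
    also have "\<dots> = (\<Sum>n. of_real (free_response (Suc n) v $ i) * u ^ n)"
      by (simp add: matrix_vector_mult_def sum_distrib_right mult.assoc)
    finally have 1: "(\<Sum>j\<in>UNIV. of_real (A $ i $ j) * ?y j) = (\<Sum>n. of_real (free_response (Suc n) v $ i) * u ^ n)" .
    have s1: "summable (\<lambda>n. of_real (free_response (Suc n) v $ i) * u ^ n)"
    proof -
      have "summable (\<lambda>n. \<Sum>j\<in>UNIV. of_real (A $ i $ j) * (of_real (free_response n v $ j) * u ^ n))"
        by (intro summable_sum summable_mult s)
      then show ?thesis
        by (simp add: matrix_vector_mult_def sum_distrib_right mult.assoc)
    qed
    have "?y i = of_real (v $ i) + (\<Sum>n. of_real (free_response (Suc n) v $ i) * u ^ Suc n)"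
      using suminf_split_head[OF s[of i]] by simp
    also have "(\<Sum>n. of_real (free_response (Suc n) v $ i) * u ^ Suc n)
        = u * (\<Sum>n. of_real (free_response (Suc n) v $ i) * u ^ n)"
      by (subst suminf_mult[OF s1, symmetric]) (simp add: mult_ac)
    finally have 2: "?y i = of_real (v $ i) + u * (\<Sum>j\<in>UNIV. of_real (A $ i $ j) * ?y j)"
      unfolding 1 .
    have "(pencil u *v response_series v u) $ i
        = (\<Sum>j\<in>UNIV. (if i = j then ?y j else 0) - u * (of_real (A $ i $ j) * ?y j))"
      unfolding matrix_vector_mult_def pencil_def by (simp add: left_diff_distrib mult.assoc if_distrib[of "\<lambda>x. x * _"] cong: if_cong)
    also have "\<dots> = ?y i - u * (\<Sum>j\<in>UNIV. of_real (A $ i $ j) * ?y j)"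
      by (simp add: sum_subtractf sum_distrib_left)
    finally show ?thesis using 2 by simp
  qed
  then show ?thesis by (simp add: vec_eq_iff)
qed

text \<open>The Neumann series at the unit vectors are the columns of a right inverse.\<close>

lemma det_pencil_nonzero:
  assumes "responses_summable u"
  shows "det (pencil u) \<noteq> 0"
proof -
  have "pencil u ** (\<chi> i j. response_series (axis j 1) u $ i) = mat 1"
  proof -
    have "(pencil u ** (\<chi> i j. response_series (axis j 1) u $ i)) $ i $ j
        = (pencil u *v response_series (axis j 1) u) $ i" for i j
      by (simp add: matrix_matrix_mult_def matrix_vector_mult_def)
    then show ?thesis
      by (simp add: pencil_mult_response_series[OF assms] vec_eq_iff mat_def axis_def)
  qed
  then show ?thesis
    using invertible_det_nz invertible_right_inverse by blast
qed

lemma pencil_num_div_det: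
  assumes "det (pencil u) \<noteq> 0" and "pencil u *v y = (\<chi> i. of_real (\<beta> $ i))"
  shows "pencil_num u / det (pencil u) = (\<Sum>k\<in>UNIV. of_real (c $ k) * y $ k)"
proof -
  have "y = (\<chi> k. det (\<chi> i j. if j = k then (\<chi> i. of_real (\<beta> $ i)) $ i else pencil u $ i $ j) / det (pencil u))"
    using cramer[OF assms(1)] assms(2) by blast
  then show ?thesis
    by (simp add: pencil_num_def sum_divide_distrib cong: if_cong)
qed

lemma impulse_response_sums:
  assumes "responses_summable u"
  shows "(\<lambda>n. of_real (impulse_response n) * u ^ n) sums (pencil_num u / det (pencil u))"
proof -
  have "(\<lambda>n. \<Sum>k\<in>UNIV. of_real (c $ k) * (of_real (free_response n \<beta> $ k) * u ^ n)) sums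
      (\<Sum>k\<in>UNIV. of_real (c $ k) * (\<Sum>n. of_real (free_response n \<beta> $ k) * u ^ n))"
    by (intro sums_sum sums_mult summable_sums) (use assms in \<open>auto simp: responses_summable_def\<close>)
  moreover have "pencil_num u / det (pencil u) = (\<Sum>k\<in>UNIV. of_real (c $ k) * response_series \<beta> u $ k)"
    by (intro pencil_num_div_det det_pencil_nonzero pencil_mult_response_series assms)
  ultimately show ?thesis
    by (simp add: impulse_response_def inner_vec_def sum_distrib_right mult.assoc)
qed

lemma transfer_function_eq:
  assumes det: "det (pencil u) \<noteq> 0" and u: "u \<noteq> 0"
    and b: "column 1 b = \<beta>" and C: "row 1 C = c"
  shows "transfer_function A b C (1 / u) = u * (pencil_num u / det (pencil u))"
proof -
  obtain X where X: "pencil u ** X = mat 1" "X ** pencil u = mat 1"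
    using det invertible_det_nz[of "pencil u"] by (auto simp: invertible_def)
  define M where "M = mat (1 / u) - map_matrix complex_of_real A"
  \<comment> \<open>Candidate inverse: \<open>(1 / u) I - A\<close> has inverse
    \<open>u (I - u A)^(-1)\<close>.\<close>
  define Z where "Z = (\<chi> i j. u * X $ i $ j)"
  have Mu: "M $ i $ j * u = pencil u $ i $ j" for i j
    using u by (simp add: M_def pencil_def map_matrix_def mat_def left_diff_distrib)
  have MZ: "M ** Z = mat 1"
  proof -
    have "M $ i $ k * Z $ k $ j = pencil u $ i $ k * X $ k $ j" for i j k
      unfolding Mu[symmetric] by (simp add: Z_def)
    then have "M ** Z = pencil u ** X" by (simp add: matrix_matrix_mult_def)
    then show ?thesis by (simp add: X)
  qed
  then have "Z ** M = mat 1" by (simp add: matrix_left_right_inverse)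
  with MZ have inv: "matrix_inv M = Z" by (rule matrix_inv_eqI)
  define y where "y = X *v (\<chi> i. complex_of_real (\<beta> $ i))"
  have y: "pencil u *v y = (\<chi> i. of_real (\<beta> $ i))"
    by (simp add: y_def matrix_vector_mul_assoc X)
  have bi: "b $ i $ 1 = \<beta> $ i" for i using b by (auto simp: column_def)
  have Ci: "C $ 1 $ i = c $ i" for i using C by (auto simp: row_def)
  have "transfer_function A b C (1 / u)
      = (map_matrix complex_of_real C ** (Z ** map_matrix complex_of_real b)) $ 1 $ 1"
    by (simp add: transfer_function_def M_def[symmetric] inv matrix_mul_assoc)
  also have "\<dots> = (\<Sum>k\<in>UNIV. of_real (c $ k) * (u * y $ k))"
    by (simp add: matrix_matrix_mult_def map_matrix_def Z_def y_def matrix_vector_mult_def bi Ci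
        sum_distrib_left mult_ac)
  also have "\<dots> = u * (pencil_num u / det (pencil u))"
    unfolding pencil_num_div_det[OF det y] by (simp add: sum_distrib_left mult_ac)
  finally show ?thesis .
qed

section \<open>Summability of the impulse response and boundary values\<close>

lemma responses_summable_near_0:
  obtains r where "0 < r" "\<And>u. cmod u < r \<Longrightarrow> responses_summable u"
proof -
  define K where "K = onorm ((*v) A) + 1"
  have "0 < K" using onorm_pos_le[OF matrix_vector_mul_bounded_linear, of A] by (simp add: K_def)
  have growth: "norm (free_response n v) \<le> K ^ n * norm v" for n v
  proof (induction n)
    case (Suc n)
    have "norm (A *v free_response n v) \<le> K * norm (free_response n v)"
      using onorm[OF matrix_vector_mul_bounded_linear, of A "free_response n v"]
      by (simp add: K_def distrib_right add_increasing2)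
    also have "\<dots> \<le> K * (K ^ n * norm v)" using Suc.IH \<open>0 < K\<close> by simp
    finally show ?case by simp
  qed simp
  have "responses_summable u" if u: "cmod u < 1 / K" for u
    unfolding responses_summable_def
  proof (intro allI)
    fix v i
    show "summable (\<lambda>n. of_real (free_response n v $ i) * u ^ n :: complex)"
    proof (rule summable_comparison_test')
      show "summable (\<lambda>n. norm v * (K * cmod u) ^ n)"
        by (intro summable_mult summable_geometric) (use u \<open>0 < K\<close> in \<open>simp add: field_simps abs_mult\<close>)
      fix n :: nat
      have "\<bar>free_response n v $ i\<bar> \<le> K ^ n * norm v"
        using component_le_norm_cart[of "free_response n v" i] growth[of n v] by linarith
      then have "\<bar>free_response n v $ i\<bar> * cmod u ^ n \<le> K ^ n * norm v * cmod u ^ n"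
        by (intro mult_right_mono) simp_all
      then show "norm (of_real (free_response n v $ i) * u ^ n :: complex) \<le> norm v * (K * cmod u) ^ n"
        by (simp add: norm_mult norm_power power_mult_distrib mult_ac)
    qed
  qed
  then show ?thesis using that[of "1 / K"] \<open>0 < K\<close> by simp
qed

text \<open>Zeros of \<open>det (pencil u)\<close> in the closed unit disc are not excluded
  outright; the assumption on the poles shows that the quotient \<open>h\<close> has no pole there.
  Filling its removable singularities gives a function holomorphic on a slightly larger disc, whose
  Taylor coefficients at \<open>0\<close> are the impulse response.\<close>

lemma summable_impulse_response:
  assumes poles: "\<And>z. is_pole (transfer_function A b C) z \<Longrightarrow> cmod z < 1"
    and b: "column 1 b = \<beta>" and C: "row 1 C = c"
  shows "summable (\<lambda>n. \<bar>impulse_response n\<bar>)"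
proof -
  define h where "h u = pencil_num u / det (pencil u)" for u
  have hol_entry: "(\<lambda>u. pencil u $ i $ j) holomorphic_on S" for i j S
    unfolding pencil_def by (auto intro!: holomorphic_intros)
  have hol_den: "(\<lambda>u. det (pencil u)) holomorphic_on S" for S
    by (intro holomorphic_on_det hol_entry)
  have hol_num: "pencil_num holomorphic_on S" for S
  proof -
    have "(\<lambda>u. (\<chi> i j. if j = k then of_real (\<beta> $ i) else pencil u $ i $ j) $ i $ j) holomorphic_on S" for i j k
      by (cases "j = k") (simp_all add: hol_entry)
    then show ?thesis
      unfolding pencil_num_def by (intro holomorphic_intros holomorphic_on_det)
  qed
  have h_analytic: "h analytic_on {u}" if "det (pencil u) \<noteq> 0" for u
    unfolding h_def
    by (intro analytic_on_divide) (use that in \<open>auto simp: analytic_on_holomorphic intro: hol_num hol_den\<close>)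
  have h_mero: "h meromorphic_on UNIV"
    unfolding h_def
    by (intro meromorphic_on_divide analytic_on_imp_meromorphic_on)
       (auto simp: analytic_on_open intro: hol_num hol_den)
  obtain r where r: "0 < r" "\<And>u. cmod u < r \<Longrightarrow> responses_summable u"
    using responses_summable_near_0 by blast
  have det0: "det (pencil 0) \<noteq> 0" using r by (intro det_pencil_nonzero) simp
  have no_pole: "\<not> is_pole h u" if u: "cmod u \<le> 1" for u
  proof
    assume pole: "is_pole h u"
    have "det (pencil u) = 0"
      using pole h_analytic analytic_at_imp_no_pole by blast
    \<comment> \<open>The determinant is nonzero at \<open>0\<close>, so its zeros are isolated and
      \<open>transfer_function_eq\<close> applies on a punctured neighbourhood of
      \<open>u\<close>.\<close>
    then obtain e where e: "0 < e" "\<And>z. z \<in> ball u e - {u} \<Longrightarrow> det (pencil z) \<noteq> 0"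
      using isolated_zeros[OF hol_den[of UNIV] open_UNIV connected_UNIV UNIV_I _ UNIV_I det0] by metis
    have "u \<noteq> 0" using \<open>det (pencil u) = 0\<close> det0 by auto
    \<comment> \<open>Inversion carries the pole of \<open>h\<close> at \<open>u\<close> to a pole
      of the transfer function at \<open>1 / u\<close>, outside the open unit disc.\<close>
    have lim: "filterlim (\<lambda>z. 1 / z) (at u) (at (1 / u))"
    proof (rule filterlim_atI)
      show "((\<lambda>z. 1 / z) \<longlongrightarrow> u) (at (1 / u))"
        using \<open>u \<noteq> 0\<close> by (auto intro!: tendsto_eq_intros)
      show "\<forall>\<^sub>F z in at (1 / u). 1 / z \<noteq> u"
        using eventually_neq_at_within[of "1 / u" "1 / u"]
        by eventually_elim (use \<open>u \<noteq> 0\<close> in \<open>auto simp: field_simps\<close>)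
    qed
    have "filterlim (\<lambda>z. h (1 / z)) at_infinity (at (1 / u))"
      using pole lim unfolding is_pole_def by (rule filterlim_compose)
    moreover have "((\<lambda>z. 1 / z) \<longlongrightarrow> u) (at (1 / u))"
      using lim by (simp add: filterlim_at)
    ultimately have inf: "filterlim (\<lambda>z. 1 / z * h (1 / z)) at_infinity (at (1 / u))"
      using \<open>u \<noteq> 0\<close> by (intro tendsto_mult_filterlim_at_infinity)
    have "\<forall>\<^sub>F w in at u. det (pencil w) \<noteq> 0"
      using e unfolding eventually_at by (intro exI[of _ e]) (auto simp: dist_commute)
    then have "\<forall>\<^sub>F z in at (1 / u). det (pencil (1 / z)) \<noteq> 0"
      using lim by (rule eventually_compose_filterlim)
    moreover have "\<forall>\<^sub>F z in at (1 / u). z \<noteq> 0"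
      using \<open>u \<noteq> 0\<close> by (intro eventually_neq_at_within)
    ultimately have eq: "\<forall>\<^sub>F z in at (1 / u). 1 / z * h (1 / z) = transfer_function A b C z"
    proof eventually_elim
      case (elim z)
      then show ?case
        using transfer_function_eq[OF elim(1) _ b C] by (simp add: h_def)
    qed
    have "is_pole (transfer_function A b C) (1 / u)"
      using inf by (intro is_pole_transform[OF _ eq refl]) (simp only: is_pole_def)
    from poles[OF this] show False
      using u \<open>u \<noteq> 0\<close> by (simp add: norm_divide field_simps)
  qed
  define f where "f = remove_sings h"
  have "f analytic_on {u}" if "cmod u \<le> 1" for u
    unfolding f_def
  proof (rule nicely_meromorphic_on_imp_analytic_at[OF remove_sings_nicely_meromorphic[OF h_mero]])
    have "isolated_singularity_at h u"
      using h_mero by (auto simp: meromorphic_on_altdef)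
    then show "\<not> is_pole (remove_sings h) u"
      using no_pole[OF that] by simp
  qed simp
  then have "f analytic_on cball 0 1"
    by (subst analytic_on_analytic_at) simp
  then obtain T where T: "open T" "cball 0 1 \<subseteq> T" "f holomorphic_on T"
    unfolding analytic_on_holomorphic by blast
  \<comment> \<open>Compactness of the closed disc gives a uniform margin \<open>e\<close>.\<close>
  obtain e where e: "0 < e" "(\<Union>x\<in>cball 0 1. ball x e) \<subseteq> T"
    using compact_subset_open_imp_ball_epsilon_subset[OF compact_cball T(1,2)] .
  have "ball 0 (1 + e) \<subseteq> T"
  proof
    fix x :: complex assume x: "x \<in> ball 0 (1 + e)"
    show "x \<in> T"
    proof (cases "cmod x \<le> 1")
      case True
      then show ?thesis using T(2) by auto
    next
      case False
      \<comment> \<open>The radial projection of \<open>x\<close> to the unit circle, at distance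
        \<open>cmod x - 1 < e\<close>.\<close>
      define y where "y = x / of_real (cmod x)"
      have "x \<noteq> 0" using False by auto
      then have "cmod y = 1" by (simp add: y_def norm_divide)
      have "x - y = (of_real (cmod x - 1)) * y"
        using \<open>x \<noteq> 0\<close> by (simp add: y_def field_simps)
      then have "cmod (x - y) = cmod x - 1"
        using \<open>cmod y = 1\<close> False by (simp only: norm_mult norm_of_real) simp
      then have "x \<in> ball y e" using x by (simp add: dist_norm norm_minus_commute)
      then show ?thesis using e(2) \<open>cmod y = 1\<close> by force
    qed
  qed
  then have hol: "f holomorphic_on ball 0 (1 + e)"
    using T(3) holomorphic_on_subset by blast
  have "f has_fps_expansion Abs_fps (\<lambda>n. of_real (impulse_response n))"
  proof (rule has_fps_expansionI)
    have "\<forall>\<^sub>F u in nhds 0. u \<in> ball 0 r"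
      using r(1) by (intro eventually_nhds_in_open) auto
    with eventually_remove_sings_eq_nhds[OF h_analytic[OF det0]]
    show "\<forall>\<^sub>F u in nhds 0. (\<lambda>n. fps_nth (Abs_fps (\<lambda>n. of_real (impulse_response n))) n * u ^ n) sums f u"
    proof eventually_elim
      case (elim u)
      then show ?case
        using impulse_response_sums[OF r(2), of u] by (simp add: f_def h_def)
    qed
  qed
  then have coeff: "(deriv ^^ n) f 0 / fact n = of_real (impulse_response n)" for n
    using fps_nth_fps_expansion by fastforce
  \<comment> \<open>A point of modulus strictly between \<open>1\<close> and \<open>1 + e\<close>:
    convergence at \<open>w\<close> gives absolute convergence at \<open>1\<close>.\<close>
  define w where "w = complex_of_real (1 + e / 2)"
  have "w \<in> ball 0 (1 + e)" "cmod 1 < cmod w"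
    using e(1) by (simp_all add: w_def del: of_real_add)
  then have "summable (\<lambda>n. of_real (impulse_response n) * w ^ n)"
    using holomorphic_power_series[OF hol, of w] by (simp add: coeff sums_iff)
  from powser_insidea[OF this \<open>cmod 1 < cmod w\<close>] show ?thesis by simp
qed

lemma inner_adjoint_response:
  "inner ((((*v) (transpose A)) ^^ j) p) v = inner p (free_response j v)"
proof (induction j arbitrary: v)
  case (Suc j)
  have "inner (transpose A *v x) v = inner x (A *v v)" for x
    using dot_lmul_matrix[of x A v] by simp
  then have "inner ((((*v) (transpose A)) ^^ Suc j) p) v = inner p (free_response j (A *v v))"
    by (simp add: Suc.IH del: transpose_matrix_vector)
  then show ?case by (simp only: funpow_Suc_right comp_apply)
qed simp

text \<open>Sandwiched between observability rows \<open>C A\<^sup>j\<close> and reachability columns \<open>A\<^sup>k b\<close>, the power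
  \<open>A\<^sup>n\<close> is the impulse response at \<open>n + j + k\<close>; so minimality turns summability of the impulse
  response into summability of \<open>A\<^sup>n\<close>.\<close>

lemma responses_summable_on_unit_circle:
  assumes sum: "summable (\<lambda>n. \<bar>impulse_response n\<bar>)"
    and reach: "span (range (\<lambda>k. free_response k \<beta>)) = UNIV"
    and obs: "span (range (\<lambda>j. (((*v) (transpose A)) ^^ j) c)) = UNIV"
    and u: "cmod u = 1"
  shows "responses_summable u"
proof -
  have lin: "free_response n (x + y) = free_response n x + free_response n y"
    "free_response n (t *\<^sub>R x) = t *\<^sub>R free_response n x" for n t x y
    by (induction n) (simp_all add: matrix_vector_right_distrib matrix_vector_mult_scaleR)
  have lin0: "free_response n 0 = 0" for n
    using lin(2)[of n 0 0] by simp
  \<comment> \<open>With one argument of \<open>S\<close> fixed, the other ones that satisfy it form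
    a subspace, so it suffices to check spanning sets.\<close>
  define S where "S p v \<longleftrightarrow> summable (\<lambda>n. \<bar>inner p (free_response n v)\<bar>)" for p v
  have add: "summable (\<lambda>n. \<bar>f n + g n\<bar>)" if "summable (\<lambda>n. \<bar>f n\<bar>)" "summable (\<lambda>n. \<bar>g n\<bar>)" for f g :: "nat \<Rightarrow> real"
    by (rule summable_comparison_test'[OF summable_add[OF that]]) (simp add: abs_triangle_ineq)
  have base: "S ((((*v) (transpose A)) ^^ j) c) (free_response k \<beta>)" for j k
  proof -
    have "inner ((((*v) (transpose A)) ^^ j) c) (free_response n (free_response k \<beta>)) = impulse_response (n + (j + k))" for n
      by (simp add: inner_adjoint_response impulse_response_def funpow_add[symmetric, THEN fun_cong, simplified comp_def] add_ac)
    then show ?thesis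
      using sum by (simp add: S_def summable_iff_shift[of "\<lambda>n. \<bar>impulse_response n\<bar>"])
  qed
  have "S ((((*v) (transpose A)) ^^ j) c) v" for j v
  proof -
    have "subspace {v. S ((((*v) (transpose A)) ^^ j) c) v}"
      by (auto simp: subspace_def S_def lin lin0 inner_add_right abs_mult add
          intro!: summable_mult intro: summable_zero)
    then have "span (range (\<lambda>k. free_response k \<beta>)) \<subseteq> {v. S ((((*v) (transpose A)) ^^ j) c) v}"
      by (intro span_minimal) (auto simp: base)
    then show ?thesis unfolding reach by auto
  qed
  moreover have "subspace {p. S p v}" for v
    by (auto simp: subspace_def S_def inner_add_left abs_mult add intro!: summable_mult)
  ultimately have "span (range (\<lambda>j. (((*v) (transpose A)) ^^ j) c)) \<subseteq> {p. S p v}" for v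
    by (intro span_minimal) auto
  then have "S p v" for p v unfolding obs by auto
  from this[of "axis _ 1"] have entry: "summable (\<lambda>n. \<bar>free_response n v $ i\<bar>)" for v i
    by (simp add: S_def inner_axis')
  show ?thesis
    unfolding responses_summable_def
  proof (intro allI)
    fix v i
    show "summable (\<lambda>n. of_real (free_response n v $ i) * u ^ n :: complex)"
      by (rule summable_comparison_test'[OF entry[of v i]]) (simp add: norm_mult norm_power u)
  qed
qed

text \<open>Here \<open>u = 1 / z\<close> on the unit circle. The factor \<open>u\<close> in front
  of the quotient raises every power by one, hence \<open>Suc n\<close> in the cosine.\<close>

lemma frequency_response:
  assumes "responses_summable (cis (- \<theta>))"
    and "column 1 b = \<beta>" "row 1 C = c"
  shows "Re (transfer_function A b C (cis \<theta>)) = (\<Sum>n. impulse_response n * cos (real (Suc n) * \<theta>))"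
proof -
  let ?u = "cis (- \<theta>)"
  have "(\<lambda>n. ?u * (of_real (impulse_response n) * ?u ^ n)) sums
      (?u * (pencil_num ?u / det (pencil ?u)))"
    by (intro sums_mult impulse_response_sums assms)
  also have "?u * (pencil_num ?u / det (pencil ?u)) = transfer_function A b C (1 / ?u)"
    using assms by (intro transfer_function_eq[symmetric] det_pencil_nonzero) auto
  also have "1 / ?u = cis \<theta>"
    by (simp add: cis_inverse[symmetric] divide_inverse del: cis_inverse)
  finally have "(\<lambda>n. Re (?u * (of_real (impulse_response n) * ?u ^ n))) sums
      Re (transfer_function A b C (cis \<theta>))"
    by (rule sums_Re)
  moreover have "Re (?u * (of_real (impulse_response n) * ?u ^ n))
      = impulse_response n * cos (real (Suc n) * \<theta>)" for n
  proof -
    have "?u * (of_real (impulse_response n) * ?u ^ n) = of_real (impulse_response n) * ?u ^ Suc n"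
      by simp
    also have "\<dots> = of_real (impulse_response n) * cis (real (Suc n) * - \<theta>)"
      by (simp only: Complex.DeMoivre)
    finally have eq: "?u * (of_real (impulse_response n) * ?u ^ n)
      = of_real (impulse_response n) * cis (real (Suc n) * - \<theta>)" .
    show ?thesis unfolding eq by simp
  qed
  ultimately show ?thesis by (simp add: sums_iff)
qed

end

subsection \<open>Reachability and observability\<close>

text \<open>A single input gives each Kalman block exactly one column, so the rank condition
  concerns the vectors \<open>A^k b\<close>; dually for the rows below.\<close>

lemma columns_controllability:
  fixes A :: "real^'m^'m" and b :: "real^1^'m"
  shows "columns (((\<lambda>M. A ** M) ^^ k) b) = {(((*v) A) ^^ k) (column 1 b)}"
proof -
  have step: "column 1 (A ** M) = A *v column 1 M" for M :: "real^1^'m"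
    by (simp add: vec_eq_iff column_def matrix_matrix_mult_def matrix_vector_mult_def)
  have "column 1 (((\<lambda>M. A ** M) ^^ k) b) = (((*v) A) ^^ k) (column 1 b)"
    by (induction k) (simp_all add: step)
  then show ?thesis by (simp add: columns_def UNIV_1)
qed

lemma rows_observability:
  fixes A :: "real^'m^'m" and C :: "real^'m^1"
  shows "rows (((\<lambda>M. M ** A) ^^ k) C) = {(((*v) (transpose A)) ^^ k) (row 1 C)}"
proof -
  have step: "row 1 (M ** A) = transpose A *v row 1 M" for M :: "real^'m^1"
    by (simp add: vec_eq_iff row_def matrix_matrix_mult_def vector_matrix_mult_def mult_ac)
  have "row 1 (((\<lambda>M. M ** A) ^^ k) C) = (((*v) (transpose A)) ^^ k) (row 1 C)"
    by (induction k) (simp_all add: step del: transpose_matrix_vector)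
  then show ?thesis by (simp add: rows_def UNIV_1)
qed

lemma span_UNIV_if_dim_CARD:
  fixes S :: "(real^'m) set"
  assumes "dim S = CARD('m)"
  shows "span S = UNIV"
  using assms dim_eq_full[of S] by simp

context scalar_system
begin

text \<open>The states reachable in \<open>N\<close> steps form a subspace; a unit impulse at time
  \<open>N - 1 - k\<close> is followed by \<open>k\<close> free steps and so produces
  \<open>A^k \<beta>\<close>.\<close>

lemma reachable:
  assumes "span ((\<lambda>k. free_response k \<beta>) ` {..<N}) = UNIV"
  shows "\<exists>w. traj 0 w N = x"
proof -
  let ?R = "{x. \<exists>w. traj 0 w N = x}"
  have "subspace ?R"
    unfolding subspace_def
  proof (intro conjI ballI allI)
    have "traj 0 (\<lambda>_. 0) N = 0" by (induction N) simp_all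
    then show "0 \<in> ?R" by blast
    show "x + y \<in> ?R" if xy: "x \<in> ?R" "y \<in> ?R" for x y
    proof -
      obtain u v where "traj 0 u N = x" "traj 0 v N = y" using xy by blast
      then have "traj 0 (\<lambda>k. u k + v k) N = x + y"
        using traj_add[of 0 0 u v N] by simp
      then show ?thesis by blast
    qed
    show "t *\<^sub>R x \<in> ?R" if x: "x \<in> ?R" for t x
    proof -
      obtain u where "traj 0 u N = x" using x by blast
      then have "traj 0 (\<lambda>k. t * u k) N = t *\<^sub>R x"
        using traj_scale[of t 0 u N] by simp
      then show ?thesis by blast
    qed
  qed
  moreover have "free_response k \<beta> \<in> ?R" if "k < N" for k
  proof -
    have "traj 0 (\<lambda>j. if j = N - 1 - k then 1 else 0) N
        = (\<Sum>j<N. if j = N - 1 - k then free_response (N - 1 - j) \<beta> else 0)"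
      unfolding traj_zero_conv by (intro sum.cong refl) simp
    also have "\<dots> = free_response k \<beta>" using that by (simp add: sum.delta')
    finally show ?thesis by blast
  qed
  ultimately have "span ((\<lambda>k. free_response k \<beta>) ` {..<N}) \<subseteq> ?R"
    by (intro span_minimal) auto
  then show ?thesis unfolding assms by auto
qed

text \<open>The outputs of the free motion are the pairings of \<open>x\<close> with the vectors
  \<open>(A^T)^j c\<close>, and these span the space.\<close>

lemma zero_if_unobserved:
  assumes obs: "span (range (\<lambda>j. (((*v) (transpose A)) ^^ j) c)) = UNIV"
    and zero: "\<And>k. inner c (free_response k x) = 0"
  shows "x = 0"
proof -
  have "subspace {p. inner p x = 0}"
    by (auto simp: subspace_def inner_add_left)
  then have "span (range (\<lambda>j. (((*v) (transpose A)) ^^ j) c)) \<subseteq> {p. inner p x = 0}"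
    by (intro span_minimal) (auto simp: inner_adjoint_response zero)
  then have "x \<in> {p. inner p x = 0}" using obs by blast
  then show ?thesis by simp
qed

end

subsection \<open>The storage matrix\<close>

text \<open>One suitable matrix is constructed with \<open>\<alpha> = 2 * (1 - \<delta>)\<close>;
  its existence then passes the properties to the choice that defines
  \<open>storage_matrix\<close>.\<close>

lemma storage_matrix_properties:
  fixes A :: "real^'m^'m" and b :: "real^1^'m" and C :: "real^'m^1" and \<delta> :: real
  assumes min: "minimal_realization A b C"
    and poles: "\<forall>z. is_pole (transfer_function A b C) z \<longrightarrow> cmod z < 1"
    and freq: "\<forall>\<theta>\<in>{0..2 * pi}. Re (transfer_function A b C (exp (\<i> * complex_of_real \<theta>))) \<le> 1 - \<delta>"
  shows "sym_pos_def (storage_matrix A b C \<delta>) \<and> dissipative A b C \<delta> (storage_matrix A b C \<delta>)"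
proof -
  interpret scalar_system A "column 1 b" "row 1 C" .
  have reach: "span ((\<lambda>k. free_response k (column 1 b)) ` {..<CARD('m)}) = UNIV"
    using min by (intro span_UNIV_if_dim_CARD)
      (simp add: minimal_realization_def controllable_def columns_controllability UNION_singleton_eq_range)
  then have reach': "span (range (\<lambda>k. free_response k (column 1 b))) = UNIV"
    by (metis (no_types) image_mono span_mono subset_UNIV top.extremum_uniqueI)
  have "span ((\<lambda>k. (((*v) (transpose A)) ^^ k) (row 1 C)) ` {..<CARD('m)}) = UNIV"
    using min by (intro span_UNIV_if_dim_CARD)
      (simp add: minimal_realization_def observable_def rows_observability UNION_singleton_eq_range
        del: transpose_matrix_vector)
  then have obs: "span (range (\<lambda>k. (((*v) (transpose A)) ^^ k) (row 1 C))) = UNIV"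
    by (metis (no_types) image_mono span_mono subset_UNIV top.extremum_uniqueI)
  have sum: "summable (\<lambda>n. \<bar>impulse_response n\<bar>)"
    using poles by (intro summable_impulse_response[of b C]) auto
  have "2 * (\<Sum>n. impulse_response n * cos (real (Suc n) * \<theta>)) \<le> 2 * (1 - \<delta>)" if "\<theta> \<in> {0..2 * pi}" for \<theta>
  proof -
    have "responses_summable (cis (- \<theta>))"
      by (intro responses_summable_on_unit_circle sum reach' obs) simp
    then show ?thesis
      using bspec[OF freq that] frequency_response[of \<theta> b C] by (simp add: cis_conv_exp)
  qed
  then have pos: "0 \<le> cost (2 * (1 - \<delta>)) N 0 w" for N w
    by (intro cost_zero_nonneg sum)
  have ex: "\<exists>N w. traj 0 w N = x" for x
    using reachable[OF reach] by blast
  obtain P where P: "sym_pos_def P"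
    "\<And>x v. quad_form P (A *v x + v *\<^sub>R column 1 b) - quad_form P x
        \<le> v * (2 * (1 - \<delta>) * v - 2 * inner (row 1 C) x)"
    using storage_exists[OF pos ex zero_if_unobserved[OF obs]] by blast
  have "dissipative A b C \<delta> P"
    unfolding dissipative_def
  proof (intro allI)
    fix x w
    have "b *v vec w = w *\<^sub>R column 1 b"
      by (simp add: vec_eq_iff matrix_vector_mult_def column_def UNIV_1)
    moreover have "(C *v x) $ 1 = inner (row 1 C) x"
      by (simp add: matrix_vector_mult_def row_def inner_vec_def)
    ultimately show "quad_form P (A *v x + b *v vec w) - quad_form P x
        \<le> 2 * w * (w - (C *v x) $ 1) - 2 * \<delta> * w\<^sup>2"
      using P(2)[of x w] by (simp add: power2_eq_square algebra_simps)
  qed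
  define Q where "Q P \<longleftrightarrow> sym_pos_def P \<and> dissipative A b C \<delta> P" for P
  have "Q P" using P(1) \<open>dissipative A b C \<delta> P\<close> by (simp only: Q_def)
  then have "Q (SOME P. Q P)" by (rule someI)
  then show ?thesis by (simp only: Q_def storage_matrix_def)
qed

theorem lemma10p5:
  fixes A :: "real^'m^'m" and b :: "real^1^'m" and C :: "real^'m^1" and \<delta> :: real
  assumes "minimal_realization A b C"
    and "\<forall>z. is_pole (transfer_function A b C) z \<longrightarrow> cmod z < 1"
    and "\<delta> > 0"
    and "\<forall>\<theta>\<in>{0..2 * pi}. Re (transfer_function A b C (exp (\<i> * complex_of_real \<theta>))) \<le> 1 - \<delta>"
  shows "let P = storage_matrix A b C \<delta> in
    sym_pos_def P \<and> dissipative A b C \<delta> P \<and>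
    (\<forall>(\<phi> :: 'h::{real_inner, complete_space} \<Rightarrow> 'h) (\<xi> :: nat \<Rightarrow> 'h^'m).
       sector_condition \<phi> \<longrightarrow>
       (\<forall>k. \<xi> (Suc k) = tensor_id A (\<xi> k) + tensor_id b (vec (\<phi> (tensor_id C (\<xi> k) $ 1)))) \<longrightarrow>
       summable (\<lambda>k. (norm (\<phi> (tensor_id C (\<xi> k) $ 1)))\<^sup>2) \<and>
       (\<Sum>k. (norm (\<phi> (tensor_id C (\<xi> k) $ 1)))\<^sup>2)
         \<le> lambda_max P / (2 * \<delta>) * (norm (\<xi> 0))\<^sup>2)"
proof -
  define P where "P = storage_matrix A b C \<delta>"
  have P: "sym_pos_def P" "dissipative A b C \<delta> P"
    using storage_matrix_properties[OF assms(1,2,4)] by (simp_all add: P_def)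
  show ?thesis
    unfolding Let_def P_def[symmetric]
    by (intro conjI allI impI P trajectory_input_energy[OF P assms(3)]) blast+
qed

end
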